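(* Let $N\ge2$ be an integer. The heat semigroup $T_t^O$ on $O_N^+$, with generator $T_L$, satisfies the spectral gap inequality with constant $m=\frac1N$: for all $x\in\mathrm{Pol}(O_N^+)_+$, $$\frac1N\,\|x-h(x)1\|_2^2\le-h(x\,T_Lx).$$
   Context: $U_s(X)=\sum_{p=0}^{\lfloor s/2\rfloor}(-1)^p\binom{s-p}{p}X^{s-2p}$ are the Chebyshev polynomials of the second kind (rescaled to $[-2,2]$): $U_0=1$, $U_1=X$, $XU_s=U_{s+1}+U_{s-1}$. $O_N^+$: the compact quantum group whose universal $C^*$-algebra is generated by self-adjoint $u_{ij}$, $1\le i,j\le N$, with $\sum_k u_{ki}u_{kj}=\delta_{ij}=\sum_k u_{ik}u_{jk}$, and $\Delta(u_{ij})=\sum_k u_{ik}\otimes u_{kj}$. Its irreducible corepresentations are $u^{(s)}$, $s\in\mathbb{N}=\{0,1,2,\dots\}$, with $u^{(0)}=1$, $u^{(1)}=(u_{ij})$, $u^{(1)}\otimes u^{(s)}\cong u^{(s+1)}\oplus u^{(s-1)}$ for $s\ge1$, and $\dim u^{(s)}=U_s(N)$. $V_s$ is the span of the coefficients $u_{ij}^{(s)}$ and $\mathrm{Pol}(O_N^+)=\bigoplus_sV_s$. The Haar state $h$ is a faithful trace on $\mathrm{Pol}(O_N^+)$, and $\|x\|_2=h(x^*x)^{1/2}$. $\mathrm{Pol}(O_N^+)_+$ is the set of $x\in\mathrm{Pol}(O_N^+)$ with $|x|=x$ (absolute value taken in the von Neumann algebra $L^\infty(O_N^+)$ generated by $\mathrm{Pol}(O_N^+)$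 in the GNS representation of $h$). The heat semigroup is $T_t^O=\exp(tT_L)$, where the generator $T_L:\mathrm{Pol}(O_N^+)\to\mathrm{Pol}(O_N^+)$ is given by $T_Lx=-\frac{U_s'(N)}{U_s(N)}x$ for $x\in V_s$. *)

theory Defs
  imports
    "HOL-Library.Cardinality"
    "HOL-Library.Complex_Order"
    "HOL-Computational_Algebra.Polynomial"
    "Jordan_Normal_Form.Matrix"
begin

section \<open>Complex vector spaces and unital complex *-algebras\<close>

class cvec = ab_group_add +
  fixes scaleC :: "complex \<Rightarrow> 'a \<Rightarrow> 'a" (infixr \<open>*\<^sub>C\<close> 75)
  assumes scaleC_add_right: "c *\<^sub>C (x + y) = c *\<^sub>C x + c *\<^sub>C y"
    and scaleC_add_left: "(c + d) *\<^sub>C x = c *\<^sub>C x + d *\<^sub>C x"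
    and scaleC_scaleC: "c *\<^sub>C (d *\<^sub>C x) = (c * d) *\<^sub>C x"
    and scaleC_one: "1 *\<^sub>C x = x"

class star_calg = cvec + ring_1 +
  fixes star :: "'a \<Rightarrow> 'a"
  assumes scaleC_mult_left: "(c *\<^sub>C x) * y = c *\<^sub>C (x * y)"
    and scaleC_mult_right: "x * (c *\<^sub>C y) = c *\<^sub>C (x * y)"
    and star_add: "star (x + y) = star x + star y"
    and star_scaleC: "star (c *\<^sub>C x) = cnj c *\<^sub>C star x"
    and star_mult: "star (x * y) = star y * star x"
    and star_star: "star (star x) = x"

interpretation cvec: vector_space "scaleC :: complex \<Rightarrow> 'a \<Rightarrow> 'a::cvec"
  by unfold_locales (simp_all add: scaleC_add_right scaleC_add_left scaleC_scaleC scaleC_one)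

abbreviation clinear :: "('a::cvec \<Rightarrow> 'b::cvec) \<Rightarrow> bool" where
  "clinear \<equiv> Vector_Spaces.linear scaleC scaleC"

abbreviation cfunctional :: "('a::cvec \<Rightarrow> complex) \<Rightarrow> bool" where
  "cfunctional \<equiv> Vector_Spaces.linear scaleC (*)"

abbreviation scalar :: "complex \<Rightarrow> 'a::star_calg" where
  "scalar c \<equiv> c *\<^sub>C 1"

lemma star_one [simp]: "star (1 :: 'a::star_calg) = 1"
  by (metis mult.left_neutral mult.right_neutral star_mult star_star)

lemma star_zero [simp]: "star (0 :: 'a::star_calg) = 0"
  by (metis add_cancel_right_right star_add)

lemma star_sum: "star (sum f A) = (\<Sum>i\<in>A. star (f i :: 'a::star_calg))"
  by (induction A rule: infinite_finite_induct) (simp_all add: star_add)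

section \<open>The algebraic tensor product\<close>

text \<open>Formal sums of pure tensors, represented as lists of pairs, modulo bilinearity.\<close>

inductive teq :: "('a::star_calg \<times> 'b::star_calg) list \<Rightarrow> ('a \<times> 'b) list \<Rightarrow> bool" where
  teq_refl: "teq p p"
| teq_sym: "teq p q \<Longrightarrow> teq q p"
| teq_trans [trans]: "teq p q \<Longrightarrow> teq q r \<Longrightarrow> teq p r"
| teq_append: "teq p p' \<Longrightarrow> teq q q' \<Longrightarrow> teq (p @ q) (p' @ q')"
| teq_comm: "teq (p @ q) (q @ p)"
| teq_zero: "teq [(0, b)] []"
| teq_add_left: "teq [(a + a', b)] [(a, b), (a', b)]"
| teq_add_right: "teq [(a, b + b')] [(a, b), (a, b')]"
| teq_scale: "teq [(c *\<^sub>C a, b)] [(a, c *\<^sub>C b)]"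

lemmas teq_gens = teq_zero teq_add_left teq_add_right teq_scale

lemma teq_equivp: "equivp teq"
  by (intro equivpI reflpI sympI transpI) (auto intro: teq_refl teq_sym teq_trans)

quotient_type (overloaded) ('a, 'b) tensor =
  "('a::star_calg \<times> 'b::star_calg) list" / teq
  by (rule teq_equivp)

lemma teq_map:
  assumes "teq p q"
    and "\<And>a a' b. teq [f (a + a', b)] [f (a, b), f (a', b)]"
    and "\<And>a b b'. teq [f (a, b + b')] [f (a, b), f (a, b')]"
    and "\<And>c a b. teq [f (c *\<^sub>C a, b)] [f (a, c *\<^sub>C b)]"
    and "\<And>b. teq [f (0, b)] []"
  shows "teq (map f p) (map f q)"
  using assms(1)
proof induction
  case teq_trans
  then show ?case by (blast intro: teq.teq_trans)
next
  case teq_sym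
  then show ?case by (blast intro: teq.teq_sym)
qed (simp_all only: map_append list.map assms(2-5) teq_refl teq_append teq_comm)

definition tscale :: "complex \<Rightarrow> ('a::star_calg \<times> 'b::star_calg) list \<Rightarrow> ('a \<times> 'b) list" where
  "tscale c p = map (\<lambda>(a, b). (c *\<^sub>C a, b)) p"

definition tstar :: "('a::star_calg \<times> 'b::star_calg) list \<Rightarrow> ('a \<times> 'b) list" where
  "tstar p = map (\<lambda>(a, b). (star a, star b)) p"

definition tmult ::
  "('a::star_calg \<times> 'b::star_calg) list \<Rightarrow> ('a \<times> 'b) list \<Rightarrow> ('a \<times> 'b) list" where
  "tmult p q = concat (map (\<lambda>(a, b). map (\<lambda>(c, d). (a * c, b * d)) q) p)"

lemma tscale_cong: "teq p q \<Longrightarrow> teq (tscale c p) (tscale c q)"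
  unfolding tscale_def
  by (rule teq_map) (auto simp: scaleC_add_right cvec.scale_left_commute[of c] intro: teq_gens
      simp del: scaleC_scaleC cvec.scale_scale)

lemma tstar_cong: "teq p q \<Longrightarrow> teq (tstar p) (tstar q)"
  unfolding tstar_def
  by (rule teq_map) (auto simp: star_add star_scaleC intro: teq_gens)

lemma tmult_Nil [simp]: "tmult [] q = []" "tmult p [] = []"
  by (induction p) (auto simp: tmult_def)

lemma tmult_append_left: "tmult (p @ p') q = tmult p q @ tmult p' q"
  by (simp add: tmult_def)

lemma tmult_Cons_left: "tmult ((a, b) # p) q = map (\<lambda>(c, d). (a * c, b * d)) q @ tmult p q"
  by (simp add: tmult_def)

lemma teq_swap: "teq (p @ q @ r @ s) (p @ r @ q @ s)"
  using teq_append[OF teq_refl[of p] teq_append[OF teq_comm[of q r] teq_refl[of s]]] by simp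

lemma tmult_append_right: "teq (tmult p (q @ q')) (tmult p q @ tmult p q')"
proof (induction p)
  case Nil
  then show ?case by (simp add: teq_refl)
next
  case (Cons x p)
  obtain a b where [simp]: "x = (a, b)" by force
  let ?m = "map (\<lambda>(c, d). (a * c, b * d))"
  have "teq (?m q @ ?m q' @ tmult p (q @ q')) (?m q @ ?m q' @ tmult p q @ tmult p q')"
    by (intro teq_append teq_refl Cons)
  also have "teq \<dots> (?m q @ tmult p q @ ?m q' @ tmult p q')"
    by (rule teq_swap)
  finally show ?case by (simp add: tmult_Cons_left)
qed

lemma tmult_cong_right: "teq q q' \<Longrightarrow> teq (tmult p q) (tmult p q')"
proof (induction p)
  case Nil
  then show ?case by (simp add: teq_refl)
next
  case (Cons x p)
  obtain a b where [simp]: "x = (a, b)" by force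
  have "teq (map (\<lambda>(c, d). (a * c, b * d)) q) (map (\<lambda>(c, d). (a * c, b * d)) q')"
    using Cons.prems
    by (rule teq_map)
      (auto simp: distrib_left scaleC_mult_right intro: teq_gens)
  then show ?case using Cons by (simp add: tmult_Cons_left teq_append)
qed

lemma tmult_singleton_right: "tmult p [(c, d)] = map (\<lambda>(a, b). (a * c, b * d)) p"
  by (induction p) (auto simp: tmult_def)

lemma tmult_cong_left: "teq p p' \<Longrightarrow> teq (tmult p q) (tmult p' q)"
proof (induction q)
  case Nil
  then show ?case by (simp add: teq_refl)
next
  case (Cons x q)
  obtain c d where [simp]: "x = (c, d)" by force
  have "teq (tmult p [x]) (tmult p' [x])"
    unfolding \<open>x = _\<close> tmult_singleton_right using Cons.prems
    by (rule teq_map)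
      (auto simp: distrib_right scaleC_mult_left intro: teq_gens)
  then have "teq (tmult p [x] @ tmult p q) (tmult p' [x] @ tmult p' q)"
    using Cons by (intro teq_append) auto
  then have "teq (tmult p ([x] @ q)) (tmult p' ([x] @ q))"
    by (meson tmult_append_right teq_sym teq_trans)
  then show ?case by simp
qed

lemma teq_zero_right: "teq [(a, 0)] []"
proof -
  have "teq [(a, 0)] [(0, 0 :: 'b)]"
    using teq_sym[OF teq_scale[of 0 a 0]] by simp
  then show ?thesis using teq_trans teq_zero by blast
qed

lemma teq_neg: "teq (tscale (-1) p @ p) []"
proof (induction p)
  case Nil
  then show ?case by (simp add: tscale_def teq_refl)
next
  case (Cons x p)
  obtain a b where [simp]: "x = (a, b)" by force
  have "teq [((-1) *\<^sub>C a, b), (a, b)] [((-1) *\<^sub>C a + a, b)]"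
    by (rule teq_sym, rule teq_add_left)
  then have 1: "teq [((-1) *\<^sub>C a, b), (a, b)] []"
    using teq_zero[of b] teq_trans by fastforce
  have "teq ([((-1) *\<^sub>C a, b)] @ tscale (-1) p @ [(a, b)] @ p)
            ([((-1) *\<^sub>C a, b)] @ [(a, b)] @ tscale (-1) p @ p)"
    by (rule teq_swap)
  also have "teq \<dots> ([] @ [])"
    using teq_append[OF 1 Cons] by simp
  finally show ?case by (simp add: tscale_def)
qed

lemma tmult_assoc: "tmult (tmult p q) r = tmult p (tmult q r)"
proof (induction p)
  case (Cons x p)
  obtain a b where [simp]: "x = (a, b)" by force
  have "tmult (map (\<lambda>(c, d). (a * c, b * d)) q) r
      = map (\<lambda>(c, d). (a * c, b * d)) (tmult q r)"
    by (induction q) (auto simp: tmult_def mult.assoc)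
  then show ?case using Cons by (simp add: tmult_Cons_left tmult_append_left)
qed simp

lemma tscale_append: "tscale c (p @ q) = tscale c p @ tscale c q"
  by (simp add: tscale_def)

lemma tscale_add: "teq (tscale (c + d) p) (tscale c p @ tscale d p)"
proof (induction p)
  case Nil
  then show ?case by (simp add: tscale_def teq_refl)
next
  case (Cons x p)
  obtain a b where [simp]: "x = (a, b)" by force
  have "teq ([((c + d) *\<^sub>C a, b)] @ tscale (c + d) p)
      ([(c *\<^sub>C a, b), (d *\<^sub>C a, b)] @ tscale c p @ tscale d p)"
    using Cons by (intro teq_append) (auto simp: scaleC_add_left intro: teq_add_left)
  also have "teq \<dots> ([(c *\<^sub>C a, b)] @ tscale c p @ [(d *\<^sub>C a, b)] @ tscale d p)"
    using teq_swap[of "[(c *\<^sub>C a, b)]" "[(d *\<^sub>C a, b)]"] by simp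
  finally show ?case by (simp add: tscale_def)
qed

lemma tmult_scale_left: "tmult (tscale c p) q = tscale c (tmult p q)"
  by (induction p) (auto simp: tmult_def tscale_def scaleC_mult_left split_def)

lemma tmult_scale_right: "tmult p (tscale c q) = tscale c (tmult p q)"
  by (induction p) (auto simp: tmult_def tscale_def scaleC_mult_right split_def)

lemma tstar_tmult: "teq (tstar (tmult p q)) (tmult (tstar q) (tstar p))"
proof (induction p)
  case Nil
  then show ?case by (simp add: tstar_def teq_refl)
next
  case (Cons x p)
  obtain a b where [simp]: "x = (a, b)" by force
  have eq: "tstar (tmult (x # p) q) = tmult (tstar q) [(star a, star b)] @ tstar (tmult p q)"
    unfolding \<open>x = _\<close> tmult_Cons_left tmult_singleton_right
    by (simp add: tstar_def split_def star_mult o_def)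
  have "teq (tmult (tstar q) [(star a, star b)] @ tstar (tmult p q))
      (tmult (tstar q) [(star a, star b)] @ tmult (tstar q) (tstar p))"
    by (intro teq_append teq_refl Cons)
  also have "teq \<dots> (tmult (tstar q) ([(star a, star b)] @ tstar p))"
    by (rule teq_sym, rule tmult_append_right)
  finally show ?case unfolding eq by (simp add: tstar_def)
qed

lemma cfunctional_iff:
  "cfunctional f \<longleftrightarrow> (\<forall>x y. f (x + y) = f x + f y) \<and> (\<forall>c x. f (c *\<^sub>C x) = c * f x)"
proof -
  have "vector_space ((*) :: complex \<Rightarrow> complex \<Rightarrow> complex)"
    by unfold_locales (simp_all add: algebra_simps)
  then show ?thesis
    by (auto simp: Vector_Spaces.linear_def module_hom_def module_hom_axioms_def
        module_iff_vector_space cvec.vector_space_axioms)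
qed

lemma teq_invariant:
  fixes F :: "'a::star_calg \<Rightarrow> 'b::star_calg \<Rightarrow> 'c::ab_group_add"
  assumes "teq p q"
    and "\<And>a a' b. F (a + a') b = F a b + F a' b"
    and "\<And>a b b'. F a (b + b') = F a b + F a b'"
    and "\<And>c a b. F (c *\<^sub>C a) b = F a (c *\<^sub>C b)"
  shows "(\<Sum>(a, b)\<leftarrow>p. F a b) = (\<Sum>(a, b)\<leftarrow>q. F a b)"
proof -
  have "F 0 b = 0" for b using assms(2)[of 0 0 b] by simp
  with assms(1) show ?thesis
    by (induction rule: teq.induct) (simp_all add: assms(2-4))
qed

lemma ex_unital_cfunctional: "\<exists>f :: 'a::star_calg \<Rightarrow> complex. cfunctional f \<and> f 1 = 1"
proof -
  have ind: "cvec.independent {1 :: 'a}" by simp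
  let ?B = "cvec.extend_basis {1 :: 'a}"
  have B: "cvec.independent ?B" "1 \<in> ?B" "\<And>x. x \<in> cvec.span ?B"
    using cvec.independent_extend_basis[OF ind] cvec.extend_basis_superset[OF ind]
      cvec.span_extend_basis[OF ind] by auto
  show ?thesis
    by (rule exI[of _ "\<lambda>x. cvec.representation ?B x 1"])
      (use B in \<open>simp add: cfunctional_iff cvec.representation_add cvec.representation_scale
        cvec.representation_basis\<close>)
qed

instantiation tensor :: (star_calg, star_calg) star_calg
begin

lift_definition zero_tensor :: "('a, 'b) tensor" is "[]" .
lift_definition one_tensor :: "('a, 'b) tensor" is "[(1, 1)]" .
lift_definition plus_tensor :: "('a, 'b) tensor \<Rightarrow> ('a, 'b) tensor \<Rightarrow> ('a, 'b) tensor"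
  is "(@)" by (rule teq_append)
lift_definition times_tensor :: "('a, 'b) tensor \<Rightarrow> ('a, 'b) tensor \<Rightarrow> ('a, 'b) tensor"
  is tmult by (meson tmult_cong_left tmult_cong_right teq_trans)
lift_definition scaleC_tensor :: "complex \<Rightarrow> ('a, 'b) tensor \<Rightarrow> ('a, 'b) tensor"
  is tscale by (rule tscale_cong)
lift_definition star_tensor :: "('a, 'b) tensor \<Rightarrow> ('a, 'b) tensor"
  is tstar by (rule tstar_cong)
definition uminus_tensor :: "('a, 'b) tensor \<Rightarrow> ('a, 'b) tensor" where
  "uminus_tensor x = (-1) *\<^sub>C x"
definition minus_tensor :: "('a, 'b) tensor \<Rightarrow> ('a, 'b) tensor \<Rightarrow> ('a, 'b) tensor" where
  "minus_tensor x y = x + (-1) *\<^sub>C y"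

instance
proof
  fix x y z :: "('a, 'b) tensor" and c d :: complex
  show comm: "x + y = y + x" for x y :: "('a, 'b) tensor" by transfer (rule teq_comm)
  show "x + y + z = x + (y + z)" by transfer (simp add: teq_refl)
  show "0 + x = x" by transfer (simp add: teq_refl)
  show "- x + x = 0" unfolding uminus_tensor_def by transfer (rule teq_neg)
  show "x - y = x + - y" by (simp add: minus_tensor_def uminus_tensor_def)
  show "x * y * z = x * (y * z)" by transfer (simp add: tmult_assoc teq_refl)
  show "1 * x = x" by transfer (simp add: tmult_def teq_refl)
  show "x * 1 = x" by transfer (simp add: tmult_singleton_right teq_refl)
  show "(x + y) * z = x * z + y * z" by transfer (simp add: tmult_append_left teq_refl)
  show "x * (y + z) = x * y + x * z" by transfer (rule tmult_append_right)
  show "c *\<^sub>C (x + y) = c *\<^sub>C x + c *\<^sub>C y" by transfer (simp add: tscale_append teq_refl)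
  show "(c + d) *\<^sub>C x = c *\<^sub>C x + d *\<^sub>C x" by transfer (rule tscale_add)
  show "c *\<^sub>C (d *\<^sub>C x) = (c * d) *\<^sub>C x"
    by transfer (simp add: tscale_def o_def split_def teq_refl)
  show "1 *\<^sub>C x = x" by transfer (simp add: tscale_def teq_refl)
  show "(c *\<^sub>C x) * y = c *\<^sub>C (x * y)" by transfer (simp add: tmult_scale_left teq_refl)
  show "x * (c *\<^sub>C y) = c *\<^sub>C (x * y)" by transfer (simp add: tmult_scale_right teq_refl)
  show "star (x + y) = star x + star y" by transfer (simp add: tstar_def teq_refl)
  show "star (c *\<^sub>C x) = cnj c *\<^sub>C star x"
    by transfer (simp add: tstar_def tscale_def star_scaleC split_def o_def teq_refl)
  show "star (x * y) = star y * star x" by transfer (rule tstar_tmult)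
  show "star (star x) = x"
    by transfer (simp add: tstar_def o_def split_def star_star teq_refl)
  show "(0 :: ('a, 'b) tensor) \<noteq> 1"
  proof transfer
    obtain f :: "'a \<Rightarrow> complex" and g :: "'b \<Rightarrow> complex"
      where "cfunctional f" "f 1 = 1" "cfunctional g" "g 1 = 1"
      using ex_unital_cfunctional by metis
    then show "\<not> teq [] [(1 :: 'a, 1 :: 'b)]"
      using teq_invariant[of "[]" "[(1, 1)]" "\<lambda>a b. f a * g b"]
      by (auto simp: cfunctional_iff algebra_simps)
  qed
qed

end

lift_definition tens :: "'a::star_calg \<Rightarrow> 'b::star_calg \<Rightarrow> ('a, 'b) tensor" (infixr \<open>\<otimes>\<^sub>A\<close> 70)
  is "\<lambda>a b. [(a, b)]" .

lemma tens_simps: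
  "(a + a') \<otimes>\<^sub>A b = a \<otimes>\<^sub>A b + a' \<otimes>\<^sub>A b"
  "a \<otimes>\<^sub>A (b + b') = a \<otimes>\<^sub>A b + a \<otimes>\<^sub>A b'"
  "(c *\<^sub>C a) \<otimes>\<^sub>A b = c *\<^sub>C (a \<otimes>\<^sub>A b)"
  "a \<otimes>\<^sub>A (c *\<^sub>C b) = c *\<^sub>C (a \<otimes>\<^sub>A b)"
  "(a \<otimes>\<^sub>A b) * (a' \<otimes>\<^sub>A b') = (a * a') \<otimes>\<^sub>A (b * b')"
  "star (a \<otimes>\<^sub>A b) = star a \<otimes>\<^sub>A star b"
  "1 \<otimes>\<^sub>A 1 = (1 :: ('a::star_calg, 'b::star_calg) tensor)"
  by (transfer, simp add: tscale_def tmult_def tstar_def teq_refl teq_gens teq_sym)+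

text \<open>The slice maps \<open>f \<otimes>\<^sub>A id\<close> and \<open>id \<otimes>\<^sub>A f\<close>. For a linear functional \<open>f\<close> they do not
  depend on the representing formal sum, as the lemmas below show.\<close>

definition slice_left ::
  "('a::star_calg \<Rightarrow> complex) \<Rightarrow> ('a, 'b::star_calg) tensor \<Rightarrow> 'b" where
  "slice_left f t = (\<Sum>(a, b)\<leftarrow>rep_tensor t. f a *\<^sub>C b)"

definition slice_right ::
  "('b \<Rightarrow> complex) \<Rightarrow> ('a::star_calg, 'b::star_calg) tensor \<Rightarrow> 'a" where
  "slice_right f t = (\<Sum>(a, b)\<leftarrow>rep_tensor t. f b *\<^sub>C a)"

lemma slice_left_abs:
  assumes "cfunctional f"
  shows "slice_left f (abs_tensor p) = (\<Sum>(a, b)\<leftarrow>p. f a *\<^sub>C b)"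
proof -
  have "teq (rep_tensor (abs_tensor p)) p"
    by (meson Quotient_rep_abs Quotient_tensor teq_refl)
  then show ?thesis using assms unfolding slice_left_def
    by (intro teq_invariant)
      (auto simp: cfunctional_iff scaleC_add_left scaleC_add_right mult.commute)
qed

lemma slice_right_abs:
  assumes "cfunctional f"
  shows "slice_right f (abs_tensor p) = (\<Sum>(a, b)\<leftarrow>p. f b *\<^sub>C a)"
proof -
  have "teq (rep_tensor (abs_tensor p)) p"
    by (meson Quotient_rep_abs Quotient_tensor teq_refl)
  then show ?thesis using assms unfolding slice_right_def
    by (intro teq_invariant)
      (auto simp: cfunctional_iff scaleC_add_left scaleC_add_right mult.commute)
qed

lemma slice_tens:
  assumes "cfunctional f"
  shows "slice_left f (a \<otimes>\<^sub>A b) = f a *\<^sub>C b" and "slice_right f (b \<otimes>\<^sub>A a) = f a *\<^sub>C b"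
  using slice_left_abs[OF assms, of "[(a, b)]"] slice_right_abs[OF assms, of "[(b, a)]"]
  by (simp_all add: tens.abs_eq)

lemma slice_add:
  assumes "cfunctional f"
  shows "slice_left f (s + t) = slice_left f s + slice_left f t"
    and "slice_right f (s' + t') = slice_right f s' + slice_right f t'"
  by (induct s rule: tensor.abs_induct, induct t rule: tensor.abs_induct,
      simp add: plus_tensor.abs_eq slice_left_abs assms)
    (induct s' rule: tensor.abs_induct, induct t' rule: tensor.abs_induct,
      simp add: plus_tensor.abs_eq slice_right_abs assms)

section \<open>Polynomial functions on the free orthogonal quantum group\<close>

text \<open>The universal unital complex *-algebra on the generators \<open>ugen i j\<close> and relations of
  \<open>O\<^sub>N\<^sup>+\<close>, as *-polynomial expressions modulo the axioms of unital *-algebras and the defining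
  relations. Here \<open>N\<close> is the number of elements of the finite index type \<open>'n\<close>.\<close>

datatype 'n oexp =
    OGen 'n 'n
  | OConst complex
  | OAdd "'n oexp" "'n oexp"
  | OMul "'n oexp" "'n oexp"
  | OStar "'n oexp"

definition osum :: "'n oexp list \<Rightarrow> 'n oexp" where
  "osum es = foldr OAdd es (OConst 0)"

inductive oeq :: "'n::finite oexp \<Rightarrow> 'n oexp \<Rightarrow> bool" where
  oeq_refl: "oeq x x"
| oeq_sym: "oeq x y \<Longrightarrow> oeq y x"
| oeq_trans: "oeq x y \<Longrightarrow> oeq y z \<Longrightarrow> oeq x z"
| oeq_add_cong: "oeq x x' \<Longrightarrow> oeq y y' \<Longrightarrow> oeq (OAdd x y) (OAdd x' y')"
| oeq_mul_cong: "oeq x x' \<Longrightarrow> oeq y y' \<Longrightarrow> oeq (OMul x y) (OMul x' y')"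
| oeq_star_cong: "oeq x x' \<Longrightarrow> oeq (OStar x) (OStar x')"
| oeq_add_assoc: "oeq (OAdd (OAdd x y) z) (OAdd x (OAdd y z))"
| oeq_add_comm: "oeq (OAdd x y) (OAdd y x)"
| oeq_add_zero: "oeq (OAdd (OConst 0) x) x"
| oeq_mul_assoc: "oeq (OMul (OMul x y) z) (OMul x (OMul y z))"
| oeq_mul_zero: "oeq (OMul (OConst 0) x) (OConst 0)"
| oeq_mul_one: "oeq (OMul (OConst 1) x) x"
| oeq_distrib_right: "oeq (OMul (OAdd x y) z) (OAdd (OMul x z) (OMul y z))"
| oeq_distrib_left: "oeq (OMul x (OAdd y z)) (OAdd (OMul x y) (OMul x z))"
| oeq_const_add: "oeq (OConst (c + d)) (OAdd (OConst c) (OConst d))"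
| oeq_const_mul: "oeq (OConst (c * d)) (OMul (OConst c) (OConst d))"
| oeq_const_central: "oeq (OMul x (OConst c)) (OMul (OConst c) x)"
| oeq_star_const: "oeq (OStar (OConst c)) (OConst (cnj c))"
| oeq_star_add: "oeq (OStar (OAdd x y)) (OAdd (OStar x) (OStar y))"
| oeq_star_mul: "oeq (OStar (OMul x y)) (OMul (OStar y) (OStar x))"
| oeq_star_star: "oeq (OStar (OStar x)) x"
| oeq_gen_selfadjoint: "oeq (OStar (OGen i j)) (OGen i j)"
| oeq_gen_columns: "distinct ks \<Longrightarrow> set ks = UNIV \<Longrightarrow>
    oeq (osum (map (\<lambda>k. OMul (OGen k i) (OGen k j)) ks)) (OConst (of_bool (i = j)))"
| oeq_gen_rows: "distinct ks \<Longrightarrow> set ks = UNIV \<Longrightarrow>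
    oeq (osum (map (\<lambda>k. OMul (OGen i k) (OGen j k)) ks)) (OConst (of_bool (i = j)))"

lemma oeq_equivp: "equivp oeq"
  by (intro equivpI reflpI sympI transpI) (auto intro: oeq_refl oeq_sym oeq_trans)

quotient_type (overloaded) 'n PolO = "'n::finite oexp" / oeq
  by (rule oeq_equivp)

text \<open>The counit (\<open>ugen i j \<mapsto> \<delta> i j\<close>), used here only to see that the algebra is not zero.\<close>

primrec ocounit :: "'n oexp \<Rightarrow> complex" where
  "ocounit (OGen i j) = of_bool (i = j)"
| "ocounit (OConst c) = c"
| "ocounit (OAdd x y) = ocounit x + ocounit y"
| "ocounit (OMul x y) = ocounit x * ocounit y"
| "ocounit (OStar x) = cnj (ocounit x)"

lemma ocounit_osum: "ocounit (osum (map f ks)) = (\<Sum>k\<leftarrow>ks. ocounit (f k))"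
  by (induction ks) (simp_all add: osum_def)

lemma sum_of_bool: "(\<Sum>k\<in>UNIV. of_bool (k = i) * f k) = (f (i::'n::finite) :: complex)"
  "(\<Sum>k\<in>UNIV. of_bool (i = k) * f k) = f i"
  by (simp_all add: of_bool_def if_distrib[of "\<lambda>x. x * _"] cong: if_cong)

lemma ocounit_cong: "oeq x y \<Longrightarrow> ocounit x = ocounit y"
proof (induction rule: oeq.induct)
  case (oeq_gen_columns ks i j)
  then show ?case
    by (simp add: ocounit_osum sum_list_distinct_conv_sum_set sum_of_bool)
next
  case (oeq_gen_rows ks i j)
  then show ?case
    by (simp add: ocounit_osum sum_list_distinct_conv_sum_set sum_of_bool eq_commute[of j i])
qed (simp_all add: algebra_simps)

instantiation PolO :: (finite) star_calg
begin

lift_definition zero_PolO :: "'a PolO" is "OConst 0" .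
lift_definition one_PolO :: "'a PolO" is "OConst 1" .
lift_definition plus_PolO :: "'a PolO \<Rightarrow> 'a PolO \<Rightarrow> 'a PolO" is OAdd by (rule oeq_add_cong)
lift_definition times_PolO :: "'a PolO \<Rightarrow> 'a PolO \<Rightarrow> 'a PolO" is OMul by (rule oeq_mul_cong)
lift_definition scaleC_PolO :: "complex \<Rightarrow> 'a PolO \<Rightarrow> 'a PolO" is "\<lambda>c. OMul (OConst c)"
  by (intro oeq_mul_cong oeq_refl)
lift_definition star_PolO :: "'a PolO \<Rightarrow> 'a PolO" is OStar by (rule oeq_star_cong)
definition uminus_PolO :: "'a PolO \<Rightarrow> 'a PolO" where
  "uminus_PolO x = (-1) *\<^sub>C x"
definition minus_PolO :: "'a PolO \<Rightarrow> 'a PolO \<Rightarrow> 'a PolO" where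
  "minus_PolO x y = x + (-1) *\<^sub>C y"

instance
proof
  fix x y z :: "'a PolO" and c d :: complex
  have one: "1 *\<^sub>C x = x" for x :: "'a PolO" by transfer (rule oeq_mul_one)
  have add: "(c + d) *\<^sub>C x = c *\<^sub>C x + d *\<^sub>C x" for c d and x :: "'a PolO"
    by transfer (meson oeq_const_add oeq_distrib_right oeq_mul_cong oeq_refl oeq_trans)
  have zero: "0 *\<^sub>C x = 0" for x :: "'a PolO" by transfer (rule oeq_mul_zero)
  have one_mult: "1 * x = x" for x :: "'a PolO" by transfer (rule oeq_mul_one)
  have star_mult: "star (x * y) = star y * star x" for x y :: "'a PolO"
    by transfer (rule oeq_star_mul)
  show "x + y = y + x" by transfer (rule oeq_add_comm)
  show "x + y + z = x + (y + z)" by transfer (rule oeq_add_assoc)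
  show "0 + x = x" by transfer (rule oeq_add_zero)
  show "- x + x = 0"
    unfolding uminus_PolO_def using add[of "-1" 1 x] by (simp add: one zero)
  show "x - y = x + - y" by (simp add: minus_PolO_def uminus_PolO_def)
  show "x * y * z = x * (y * z)" by transfer (rule oeq_mul_assoc)
  show "1 * x = x" by (rule one_mult)
  show "x * 1 = x" by transfer (meson oeq_const_central oeq_mul_one oeq_trans)
  show "(x + y) * z = x * z + y * z" by transfer (rule oeq_distrib_right)
  show "x * (y + z) = x * y + x * z" by transfer (rule oeq_distrib_left)
  show "c *\<^sub>C (x + y) = c *\<^sub>C x + c *\<^sub>C y" by transfer (rule oeq_distrib_left)
  show "(c + d) *\<^sub>C x = c *\<^sub>C x + d *\<^sub>C x" by (rule add)
  show "c *\<^sub>C (d *\<^sub>C x) = (c * d) *\<^sub>C x"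
    by transfer (meson oeq_const_mul oeq_mul_assoc oeq_mul_cong oeq_refl oeq_sym oeq_trans)
  show "1 *\<^sub>C x = x" by (rule one)
  show "(c *\<^sub>C x) * y = c *\<^sub>C (x * y)" by transfer (rule oeq_mul_assoc)
  show "x * (c *\<^sub>C y) = c *\<^sub>C (x * y)"
    by transfer (meson oeq_const_central oeq_mul_assoc oeq_mul_cong oeq_refl oeq_sym oeq_trans)
  show "star (x + y) = star x + star y" by transfer (rule oeq_star_add)
  show "star (c *\<^sub>C x) = cnj c *\<^sub>C star x"
    by transfer (meson oeq_star_mul oeq_const_central oeq_mul_cong oeq_refl oeq_star_const
        oeq_trans)
  show "star (x * y) = star y * star x" by (rule star_mult)
  show "star (star x) = x" by transfer (rule oeq_star_star)
  show "(0 :: 'a PolO) \<noteq> 1" by transfer (use ocounit_cong in force)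
qed

end

lift_definition ugen :: "'n::finite \<Rightarrow> 'n \<Rightarrow> 'n PolO" is OGen .

lemma scalar_PolO: "(scalar c :: 'n::finite PolO) = abs_PolO (OConst c)"
  by (simp add: one_PolO_def scaleC_PolO.abs_eq PolO.abs_eq_iff)
    (meson oeq_const_central oeq_mul_one oeq_trans)

lemma abs_PolO_osum: "abs_PolO (osum (map f ks)) = (\<Sum>k\<leftarrow>ks. abs_PolO (f k))"
  by (induction ks) (simp_all add: osum_def plus_PolO.abs_eq[symmetric] zero_PolO.abs_eq)

lemma star_u: "star (ugen i j) = ugen i j"
  by transfer (rule oeq_gen_selfadjoint)

lemma u_columns: "(\<Sum>k\<in>UNIV. ugen k i * ugen k j) = scalar (of_bool (i = j))"
proof -
  obtain ks :: "'a list" where ks: "distinct ks" "set ks = UNIV"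
    using finite_distinct_list[OF finite[of UNIV]] by metis
  from oeq_gen_columns[OF this, of i j] show ?thesis
    by (simp add: PolO.abs_eq_iff[symmetric] abs_PolO_osum scalar_PolO ugen.abs_eq times_PolO.abs_eq
        flip: sum_list_distinct_conv_sum_set[OF ks(1)] ks(2))
qed

lemma u_rows: "(\<Sum>k\<in>UNIV. ugen i k * ugen j k) = scalar (of_bool (i = j))"
proof -
  obtain ks :: "'a list" where ks: "distinct ks" "set ks = UNIV"
    using finite_distinct_list[OF finite[of UNIV]] by metis
  from oeq_gen_rows[OF this, of i j] show ?thesis
    by (simp add: PolO.abs_eq_iff[symmetric] abs_PolO_osum scalar_PolO ugen.abs_eq times_PolO.abs_eq
        flip: sum_list_distinct_conv_sum_set[OF ks(1)] ks(2))
qed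

text \<open>The comultiplication is the unital *-homomorphism with
  \<open>\<Delta> (ugen i j) = (\<Sum>k. ugen i k \<otimes>\<^sub>A ugen k j)\<close>, first defined on expressions.\<close>

primrec ocomult :: "'n::finite oexp \<Rightarrow> ('n PolO, 'n PolO) tensor" where
  "ocomult (OGen i j) = (\<Sum>k\<in>UNIV. ugen i k \<otimes>\<^sub>A ugen k j)"
| "ocomult (OConst c) = scalar c"
| "ocomult (OAdd x y) = ocomult x + ocomult y"
| "ocomult (OMul x y) = ocomult x * ocomult y"
| "ocomult (OStar x) = star (ocomult x)"

lemma ocomult_osum: "ocomult (osum (map f ks)) = (\<Sum>k\<leftarrow>ks. ocomult (f k))"
  by (induction ks) (simp_all add: osum_def)

lemma tens_zero [simp]: "0 \<otimes>\<^sub>A b = 0" "a \<otimes>\<^sub>A 0 = 0"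
  using tens_simps(3)[of 0 0 b] tens_simps(4)[of a 0 0] by simp_all

lemma tens_sum: "(\<Sum>i\<in>A. f i) \<otimes>\<^sub>A b = (\<Sum>i\<in>A. f i \<otimes>\<^sub>A b)" "a \<otimes>\<^sub>A (\<Sum>i\<in>A. g i) = (\<Sum>i\<in>A. a \<otimes>\<^sub>A g i)"
  by (induction A rule: infinite_finite_induct; simp add: tens_simps)+

lemma tens_delta:
  "scalar (of_bool (l = m)) \<otimes>\<^sub>A b = (if l = m then 1 \<otimes>\<^sub>A b else 0)"
  "a \<otimes>\<^sub>A scalar (of_bool (l = m)) = (if l = m then a \<otimes>\<^sub>A 1 else 0)"
  by simp_all

lemma ocomult_columns:
  "(\<Sum>k\<in>UNIV. (\<Sum>l\<in>UNIV. ugen k l \<otimes>\<^sub>A ugen l i) * (\<Sum>m\<in>UNIV. ugen k m \<otimes>\<^sub>A ugen m j))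
    = (scalar (of_bool (i = j)) :: ('n::finite PolO, 'n PolO) tensor)" (is "?L = _")
proof -
  have "?L = (\<Sum>k\<in>UNIV. \<Sum>l\<in>UNIV. \<Sum>m\<in>UNIV. (ugen k l * ugen k m) \<otimes>\<^sub>A (ugen l i * ugen m j))"
    by (simp add: sum_product tens_simps)
  also have "\<dots> = (\<Sum>l\<in>UNIV. \<Sum>k\<in>UNIV. \<Sum>m\<in>UNIV. (ugen k l * ugen k m) \<otimes>\<^sub>A (ugen l i * ugen m j))"
    by (rule sum.swap)
  also have "\<dots> = (\<Sum>l\<in>UNIV. \<Sum>m\<in>UNIV. \<Sum>k\<in>UNIV. (ugen k l * ugen k m) \<otimes>\<^sub>A (ugen l i * ugen m j))"
    by (intro sum.cong refl sum.swap)
  also have "\<dots> = (\<Sum>l\<in>UNIV. \<Sum>m\<in>UNIV. scalar (of_bool (l = m)) \<otimes>\<^sub>A (ugen l i * ugen m j))"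
    by (simp add: tens_sum(1)[symmetric] u_columns)
  also have "\<dots> = (\<Sum>l\<in>UNIV. 1 \<otimes>\<^sub>A (ugen l i * ugen l j))"
    by (simp add: tens_delta)
  also have "\<dots> = scalar (of_bool (i = j))"
    by (simp add: tens_sum(2)[symmetric] u_columns tens_simps)
  finally show ?thesis .
qed

lemma ocomult_rows:
  "(\<Sum>k\<in>UNIV. (\<Sum>l\<in>UNIV. ugen i l \<otimes>\<^sub>A ugen l k) * (\<Sum>m\<in>UNIV. ugen j m \<otimes>\<^sub>A ugen m k))
    = (scalar (of_bool (i = j)) :: ('n::finite PolO, 'n PolO) tensor)" (is "?L = _")
proof -
  have "?L = (\<Sum>k\<in>UNIV. \<Sum>l\<in>UNIV. \<Sum>m\<in>UNIV. (ugen i l * ugen j m) \<otimes>\<^sub>A (ugen l k * ugen m k))"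
    by (simp add: sum_product tens_simps)
  also have "\<dots> = (\<Sum>l\<in>UNIV. \<Sum>k\<in>UNIV. \<Sum>m\<in>UNIV. (ugen i l * ugen j m) \<otimes>\<^sub>A (ugen l k * ugen m k))"
    by (rule sum.swap)
  also have "\<dots> = (\<Sum>l\<in>UNIV. \<Sum>m\<in>UNIV. \<Sum>k\<in>UNIV. (ugen i l * ugen j m) \<otimes>\<^sub>A (ugen l k * ugen m k))"
    by (intro sum.cong refl sum.swap)
  also have "\<dots> = (\<Sum>l\<in>UNIV. \<Sum>m\<in>UNIV. (ugen i l * ugen j m) \<otimes>\<^sub>A scalar (of_bool (l = m)))"
    by (simp add: tens_sum(2)[symmetric] u_rows)
  also have "\<dots> = (\<Sum>l\<in>UNIV. (ugen i l * ugen j l) \<otimes>\<^sub>A 1)"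
    by (simp add: tens_delta)
  also have "\<dots> = scalar (of_bool (i = j))"
    by (simp add: tens_sum(1)[symmetric] u_rows tens_simps)
  finally show ?thesis .
qed

lemma ocomult_cong: "oeq x y \<Longrightarrow> ocomult x = ocomult y"
proof (induction rule: oeq.induct)
  case (oeq_gen_columns ks i j)
  then show ?case
    by (simp add: ocomult_osum sum_list_distinct_conv_sum_set ocomult_columns)
next
  case (oeq_gen_rows ks i j)
  then show ?case
    by (simp add: ocomult_osum sum_list_distinct_conv_sum_set ocomult_rows)
next
  case (oeq_gen_selfadjoint i j)
  then show ?case by (simp add: star_sum tens_simps star_u)
qed (simp_all add: algebra_simps scaleC_mult_left scaleC_mult_right scaleC_add_left
    star_add star_mult star_star star_scaleC)

lift_definition \<Delta> :: "'n::finite PolO \<Rightarrow> ('n PolO, 'n PolO) tensor" is ocomult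
  by (rule ocomult_cong)

lemma \<Delta>_ugen: "\<Delta> (ugen i j) = (\<Sum>k\<in>UNIV. ugen i k \<otimes>\<^sub>A ugen k j)"
  by (simp add: ugen.abs_eq \<Delta>.abs_eq)

lemma \<Delta>_one: "\<Delta> 1 = 1"
  by transfer simp

lemma \<Delta>_add: "\<Delta> (x + y) = \<Delta> x + \<Delta> y"
  by transfer simp

lemma \<Delta>_mult: "\<Delta> (x * y) = \<Delta> x * \<Delta> y"
  by transfer simp

lemma \<Delta>_scaleC: "\<Delta> (c *\<^sub>C x) = c *\<^sub>C \<Delta> x"
  by transfer (simp add: scaleC_mult_left)

lemma \<Delta>_star: "\<Delta> (star x) = star (\<Delta> x)"
  by transfer simp

definition haar_state :: "('n::finite PolO \<Rightarrow> complex) \<Rightarrow> bool" where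
  "haar_state h \<longleftrightarrow> cfunctional h \<and> h 1 = 1 \<and> (\<forall>x. 0 \<le> h (star x * x)) \<and>
    (\<forall>x. slice_left h (\<Delta> x) = scalar (h x) \<and> slice_right h (\<Delta> x) = scalar (h x))"

definition norm2 :: "('a::star_calg \<Rightarrow> complex) \<Rightarrow> 'a \<Rightarrow> real" where
  "norm2 h x = sqrt (Re (h (star x * x)))"

section \<open>Finite-dimensional corepresentations\<close>

definition corepresentation :: "'n::finite PolO mat \<Rightarrow> bool" where
  "corepresentation v \<longleftrightarrow> invertible_mat v \<and>
    (\<forall>i<dim_row v. \<forall>j<dim_row v.
      \<Delta> (v $$ (i, j)) = (\<Sum>k<dim_row v. v $$ (i, k) \<otimes>\<^sub>A v $$ (k, j)))"

definition equivalent_corep :: "'n::finite PolO mat \<Rightarrow> 'n PolO mat \<Rightarrow> bool" where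
  "equivalent_corep v w \<longleftrightarrow>
    (\<exists>T :: complex mat. invertible_mat T \<and> dim_row T = dim_row v \<and> dim_col T = dim_row w \<and>
      v * map_mat scalar T = map_mat scalar T * w)"

definition direct_sum_corep :: "'n::finite PolO mat \<Rightarrow> 'n PolO mat \<Rightarrow> 'n PolO mat" where
  "direct_sum_corep v w =
    four_block_mat v (0\<^sub>m (dim_row v) (dim_col w)) (0\<^sub>m (dim_row w) (dim_col v)) w"

definition tensor_corep :: "'n::finite PolO mat \<Rightarrow> 'n PolO mat \<Rightarrow> 'n PolO mat" where
  "tensor_corep v w = mat (dim_row v * dim_row w) (dim_col v * dim_col w)
    (\<lambda>(i, j). v $$ (i div dim_row w, j div dim_col w) * w $$ (i mod dim_row w, j mod dim_col w))"

definition vec_subspace :: "nat \<Rightarrow> complex vec set \<Rightarrow> bool" where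
  "vec_subspace d W \<longleftrightarrow> W \<subseteq> carrier_vec d \<and> 0\<^sub>v d \<in> W \<and>
    (\<forall>x\<in>W. \<forall>y\<in>W. x + y \<in> W) \<and> (\<forall>c. \<forall>x\<in>W. c \<cdot>\<^sub>v x \<in> W)"

text \<open>The subspace \<open>W \<otimes> A\<close> of \<open>\<complex>\<^sup>d \<otimes> A\<close>, the latter identified with the vectors of length
  \<open>d\<close> over \<open>A\<close>.\<close>

definition vec_subspace_ext :: "nat \<Rightarrow> complex vec set \<Rightarrow> 'a::star_calg vec set" where
  "vec_subspace_ext d W =
    {vec d (\<lambda>i. \<Sum>k<m. (w k $ i) *\<^sub>C a k) | (m :: nat) w a. \<forall>k<m. w k \<in> W}"

definition invariant_subspace :: "'n::finite PolO mat \<Rightarrow> complex vec set \<Rightarrow> bool" where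
  "invariant_subspace v W \<longleftrightarrow> vec_subspace (dim_row v) W \<and>
    (\<forall>w\<in>W. v *\<^sub>v map_vec scalar w \<in> vec_subspace_ext (dim_row v) W)"

definition irreducible_corep :: "'n::finite PolO mat \<Rightarrow> bool" where
  "irreducible_corep v \<longleftrightarrow> corepresentation v \<and> dim_row v > 0 \<and>
    (\<forall>W. invariant_subspace v W \<longrightarrow> W = {0\<^sub>v (dim_row v)} \<or> W = carrier_vec (dim_row v))"

definition coefficient_space :: "'n::finite PolO mat \<Rightarrow> 'n PolO set" where
  "coefficient_space v = cvec.span {v $$ (i, j) | i j. i < dim_row v \<and> j < dim_col v}"

definition cheb :: "nat \<Rightarrow> real poly" where
  "cheb s = (\<Sum>p\<le>s div 2. monom ((-1) ^ p * of_nat ((s - p) choose p)) (s - 2 * p))"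

text \<open>The fundamental corepresentation is indexed by the type \<open>'n\<close>, matrices by an initial
  segment of the natural numbers; hence the enumeration \<open>e\<close>.\<close>

definition irreducibles_O :: "(nat \<Rightarrow> 'n::finite PolO mat) \<Rightarrow> bool" where
  "irreducibles_O U \<longleftrightarrow>
    (\<forall>s. irreducible_corep (U s)) \<and>
    (\<forall>v. irreducible_corep v \<longrightarrow> (\<exists>s. equivalent_corep v (U s))) \<and>
    U 0 = 1\<^sub>m 1 \<and>
    (\<exists>e. bij_betw e {..<CARD('n)} (UNIV :: 'n set) \<and>
      U 1 = mat CARD('n) CARD('n) (\<lambda>(i, j). ugen (e i) (e j))) \<and>
    (\<forall>s\<ge>1. equivalent_corep (tensor_corep (U 1) (U s))
      (direct_sum_corep (U (s + 1)) (U (s - 1)))) \<and>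
    (\<forall>s. real (dim_row (U s)) = poly (cheb s) (real CARD('n)))"

section \<open>The heat semigroup\<close>

definition heat_generator ::
  "(nat \<Rightarrow> 'n::finite PolO mat) \<Rightarrow> ('n PolO \<Rightarrow> 'n PolO) \<Rightarrow> bool" where
  "heat_generator U L \<longleftrightarrow> clinear L \<and>
    (\<forall>s. \<forall>x\<in>coefficient_space (U s). L x =
      complex_of_real (- (poly (pderiv (cheb s)) (real CARD('n)) / poly (cheb s) (real CARD('n))))
        *\<^sub>C x)"

text \<open>\<open>T t = exp (t L)\<close>. For an operator \<open>L\<close> under which every vector lies in a finite-dimensional
  invariant subspace, convergence of the exponential series inside that subspace is the same as
  convergence after applying any linear functional.\<close>

definition exp_semigroup ::
  "('a::cvec \<Rightarrow> 'a) \<Rightarrow> (real \<Rightarrow> 'a \<Rightarrow> 'a) \<Rightarrow> bool" where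
  "exp_semigroup L T \<longleftrightarrow> (\<forall>t\<ge>0. \<forall>x f. cfunctional f \<longrightarrow>
    (\<lambda>n. complex_of_real (t ^ n / fact n) * f ((L ^^ n) x)) sums f (T t x))"

section \<open>GNS representation and positive elements\<close>

class chilbert = cvec +
  fixes cinner :: "'a \<Rightarrow> 'a \<Rightarrow> complex"
  assumes cinner_commute: "cinner x y = cnj (cinner y x)"
    and cinner_add_right: "cinner x (y + z) = cinner x y + cinner x z"
    and cinner_scaleC_right: "cinner x (c *\<^sub>C y) = c * cinner x y"
    and cinner_nonneg: "0 \<le> cinner x x"
    and cinner_eq_zero: "cinner x x = 0 \<Longrightarrow> x = 0"
    and cinner_complete:
      "(\<And>e. e > 0 \<Longrightarrow> \<exists>M. \<forall>m\<ge>M. \<forall>n\<ge>M. sqrt (Re (cinner (X m - X n) (X m - X n))) < e) \<Longrightarrow>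
       \<exists>l. \<forall>e>0. \<exists>M. \<forall>n\<ge>(M::nat). sqrt (Re (cinner (X n - l) (X n - l))) < e"

definition cnorm :: "'k::chilbert \<Rightarrow> real" where
  "cnorm v = sqrt (Re (cinner v v))"

definition bounded_op :: "('k::chilbert \<Rightarrow> 'k) \<Rightarrow> bool" where
  "bounded_op S \<longleftrightarrow> clinear S \<and> (\<exists>C. \<forall>v. cnorm (S v) \<le> C * cnorm v)"

definition adjoint_ops :: "('k::chilbert \<Rightarrow> 'k) \<Rightarrow> ('k \<Rightarrow> 'k) \<Rightarrow> bool" where
  "adjoint_ops S S' \<longleftrightarrow> (\<forall>v w. cinner (S v) w = cinner v (S' w))"

definition positive_op :: "('k::chilbert \<Rightarrow> 'k) \<Rightarrow> bool" where
  "positive_op S \<longleftrightarrow> bounded_op S \<and> (\<forall>v. 0 \<le> cinner v (S v))"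

definition commutant :: "('k::chilbert \<Rightarrow> 'k) set \<Rightarrow> ('k \<Rightarrow> 'k) set" where
  "commutant M = {S. bounded_op S \<and> (\<forall>R\<in>M. S \<circ> R = R \<circ> S)}"

definition gns_representation ::
  "('a::star_calg \<Rightarrow> complex) \<Rightarrow> ('a \<Rightarrow> 'k::chilbert \<Rightarrow> 'k) \<Rightarrow> 'k \<Rightarrow> bool" where
  "gns_representation h \<pi> \<xi> \<longleftrightarrow>
    (\<forall>x. bounded_op (\<pi> x)) \<and>
    (\<forall>x y v. \<pi> (x + y) v = \<pi> x v + \<pi> y v) \<and>
    (\<forall>c x v. \<pi> (c *\<^sub>C x) v = c *\<^sub>C \<pi> x v) \<and>
    (\<forall>x y. \<pi> (x * y) = \<pi> x \<circ> \<pi> y) \<and>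
    \<pi> 1 = id \<and>
    (\<forall>x. adjoint_ops (\<pi> x) (\<pi> (star x))) \<and>
    (\<forall>x. h x = cinner \<xi> (\<pi> x \<xi>)) \<and>
    (\<forall>v. \<forall>e>0. \<exists>x. cnorm (\<pi> x \<xi> - v) < e)"

text \<open>The von Neumann algebra generated by the image of \<open>\<pi>\<close>, as its bicommutant.\<close>

definition generated_vn :: "('a::star_calg \<Rightarrow> 'k::chilbert \<Rightarrow> 'k) \<Rightarrow> ('k \<Rightarrow> 'k) set" where
  "generated_vn \<pi> = commutant (commutant (range \<pi>))"

text \<open>\<open>is_abs_op M R S\<close>: \<open>S\<close> is the absolute value of \<open>R\<close> in the von Neumann algebra \<open>M\<close>, that
  is, the positive square root of \<open>R\<^sup>* R\<close> (positive square roots are unique).\<close>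

definition is_abs_op ::
  "('k::chilbert \<Rightarrow> 'k) set \<Rightarrow> ('k \<Rightarrow> 'k) \<Rightarrow> ('k \<Rightarrow> 'k) \<Rightarrow> bool" where
  "is_abs_op M R S \<longleftrightarrow> S \<in> M \<and> positive_op S \<and> (\<exists>R'. adjoint_ops R R' \<and> S \<circ> S = R' \<circ> R)"

definition positive_part :: "('a::star_calg \<Rightarrow> 'k::chilbert \<Rightarrow> 'k) \<Rightarrow> 'a set" where
  "positive_part \<pi> = {x. is_abs_op (generated_vn \<pi>) (\<pi> x) (\<pi> x)}"

end

theory Submission
  imports Defs
begin

text \<open>The subspaces \<open>V s\<close> are pairwise orthogonal for the Haar state and span the algebra, so both
  sides of the inequality are combinations of the \<open>\<parallel>x\<^sub>s\<parallel>\<^sup>2\<close>, where \<open>x\<^sub>s\<close> is the component of \<open>x\<close>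
  in \<open>V s\<close>, and it suffices that \<open>U\<^sub>s'(N) / U\<^sub>s(N) \<ge> 1 / N\<close> for \<open>s \<ge> 1\<close>. The latter holds
  because \<open>U\<^sub>s'(N) \<ge> U\<^sub>s\<^sub>-\<^sub>1(N)\<close> and \<open>N U\<^sub>s\<^sub>-\<^sub>1(N) = U\<^sub>s(N) + U\<^sub>s\<^sub>-\<^sub>2(N)\<close>. Orthogonality needs no antipode:
  the fusion rule reduces it to the vanishing of the Haar state on \<open>V s\<close>, \<open>s \<ge> 1\<close>. Positivity of
  \<open>x\<close> enters only through \<open>h (x * z) = h (star x * z)\<close>.\<close>

section \<open>Chebyshev polynomials at a point not less than 2\<close>

text \<open>The binomial coefficient vanishes once \<open>p\<close> exceeds \<open>s div 2\<close>,
  so sums belonging to different degrees can be compared over one common range.\<close>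

lemma cheb_extend:
  assumes "s div 2 \<le> K"
  shows "cheb s = (\<Sum>p\<le>K. monom ((-1) ^ p * of_nat ((s - p) choose p)) (s - 2 * p))"
  unfolding cheb_def
  by (rule sum.mono_neutral_left) (use assms in \<open>auto simp: not_le intro!: binomial_eq_0\<close>)

lemma cheb_0: "cheb 0 = 1" and cheb_1: "cheb (Suc 0) = [:0, 1:]"
  by (simp_all add: cheb_def monom_0 monom_Suc)

text \<open>Pascal's rule splits every coefficient after the leading one into a coefficient of
  \<open>[:0, 1:] * cheb (Suc s)\<close> and, up to sign, one of \<open>cheb s\<close>.\<close>

lemma cheb_Suc_Suc: "cheb (Suc (Suc s)) = [:0, 1:] * cheb (Suc s) - cheb s"
proof -
  let ?m = "\<lambda>s p. monom ((-1) ^ p * real ((s - p) choose p)) (s - 2 * p)"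
  have shift: "[:0, 1:] * ?m (Suc s) p = monom ((-1) ^ p * real ((Suc s - p) choose p)) (Suc (Suc s) - 2 * p)" for p
  proof (cases "2 * p \<le> Suc s")
    case True
    then show ?thesis by (simp add: monom_Suc Suc_diff_le del: One_nat_def)
  next
    case False
    \<comment> \<open>Truncated subtraction makes the exponents on the two sides differ here, but
      the common coefficient is zero.\<close>
    then have "(Suc s - p) choose p = 0" by (intro binomial_eq_0) auto
    then show ?thesis by (simp only: of_nat_0 mult_zero_right monom_eq_0)
  qed
  \<comment> \<open>\<open>a q\<close> is the term of index \<open>Suc q\<close> in
    \<open>[:0, 1:] * cheb (Suc s)\<close>.\<close>
  define a where "a q = monom ((-1) ^ Suc q * real ((s - q) choose Suc q)) (s - 2 * q)" for q
  have step: "?m (Suc (Suc s)) (Suc q) = a q - ?m s q" if "q \<le> s" for q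
  proof -
    from that have "Suc (Suc s) - Suc q = Suc (s - q)" by simp
    then have "(Suc (Suc s) - Suc q) choose Suc q = ((s - q) choose q) + ((s - q) choose Suc q)"
      by simp
    moreover have "Suc (Suc s) - 2 * Suc q = s - 2 * q" by simp
    ultimately show ?thesis
      by (simp only: a_def diff_monom) (simp add: algebra_simps)
  qed
  have "cheb (Suc (Suc s)) = (\<Sum>p\<le>Suc s. ?m (Suc (Suc s)) p)"
    by (rule cheb_extend) simp
  also have "\<dots> = ?m (Suc (Suc s)) 0 + (\<Sum>q\<le>s. ?m (Suc (Suc s)) (Suc q))"
    by (rule sum.atMost_Suc_shift)
  also have "(\<Sum>q\<le>s. ?m (Suc (Suc s)) (Suc q)) = (\<Sum>q\<le>s. a q - ?m s q)"
    by (rule sum.cong) (use step in auto)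
  also have "?m (Suc (Suc s)) 0 + \<dots> = (?m (Suc (Suc s)) 0 + (\<Sum>q\<le>s. a q)) - (\<Sum>q\<le>s. ?m s q)"
    by (simp only: sum_subtractf add_diff_eq)
  also have "?m (Suc (Suc s)) 0 + (\<Sum>q\<le>s. a q) = (\<Sum>p\<le>Suc s. [:0, 1:] * ?m (Suc s) p)"
    unfolding shift sum.atMost_Suc_shift by (simp add: a_def)
  also have "\<dots> = [:0, 1:] * cheb (Suc s)"
    unfolding sum_distrib_left[symmetric] by (subst cheb_extend[of _ "Suc s"]) auto
  also have "(\<Sum>q\<le>s. ?m s q) = cheb s"
    by (rule cheb_extend[symmetric]) simp
  finally show ?thesis .
qed

text \<open>For \<open>x \<ge> 2\<close> the recurrence makes the sequence convex in
  \<open>s\<close>, so no increment is smaller than the first one, \<open>x - 1\<close>.\<close>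

lemma cheb_ge:
  assumes "x \<ge> 2"
  shows "poly (cheb s) x \<ge> 1 \<and> poly (cheb (Suc s)) x \<ge> poly (cheb s) x + 1"
proof (induction s)
  case 0
  then show ?case using assms by (simp add: cheb_0 cheb_1)
next
  case (Suc s)
  then have "2 * poly (cheb (Suc s)) x \<le> x * poly (cheb (Suc s)) x"
    using assms by (intro mult_right_mono) auto
  moreover have "poly (cheb (Suc (Suc s))) x = x * poly (cheb (Suc s)) x - poly (cheb s) x"
    by (simp add: cheb_Suc_Suc)
  ultimately show ?case using Suc by linarith
qed

text \<open>Differentiating the recurrence leaves the extra summand \<open>cheb (Suc s)\<close>,
  which supplies the increment. Nonnegativity is carried along so that the factor \<open>x\<close>
  can be bounded below by 2.\<close>

lemma pderiv_cheb_ge: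
  assumes "x \<ge> 2"
  shows "poly (pderiv (cheb s)) x \<ge> 0 \<and>
    poly (pderiv (cheb (Suc s))) x \<ge> poly (pderiv (cheb s)) x + poly (cheb s) x"
proof (induction s)
  case 0
  then show ?case by (simp add: cheb_0 cheb_1 pderiv_pCons)
next
  case (Suc s)
  let ?d = "\<lambda>s. poly (pderiv (cheb s)) x"
  have "?d (Suc s) \<ge> 0" "?d s \<le> ?d (Suc s)" using Suc cheb_ge[OF assms, of s] by auto
  then have "2 * ?d (Suc s) \<le> x * ?d (Suc s)"
    using assms by (intro mult_right_mono)
  moreover have "?d (Suc (Suc s)) = poly (cheb (Suc s)) x + x * ?d (Suc s) - ?d s"
    by (simp add: cheb_Suc_Suc pderiv_diff pderiv_mult pderiv_pCons algebra_simps)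
  ultimately show ?case using \<open>?d s \<le> ?d (Suc s)\<close> \<open>?d (Suc s) \<ge> 0\<close> by auto
qed

text \<open>Equality holds for \<open>s = 1\<close>, which is where the constant 1/N of the spectral
  gap comes from.\<close>

lemma cheb_log_derivative_ge:
  assumes "x \<ge> 2" and "s \<ge> 1"
  shows "1 / x \<le> poly (pderiv (cheb s)) x / poly (cheb s) x"
proof -
  obtain r where r: "s = Suc r" using assms(2) by (cases s) auto
  have le: "poly (cheb r) x \<le> poly (pderiv (cheb (Suc r))) x"
    using pderiv_cheb_ge[OF assms(1), of r] by auto
  have "poly (cheb (Suc r)) x \<le> x * poly (cheb r) x"
  proof (cases r)
    case (Suc q)
    then show ?thesis using cheb_ge[OF assms(1), of q] by (simp add: cheb_Suc_Suc)
  qed (simp add: cheb_0 cheb_1)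
  also have "\<dots> \<le> x * poly (pderiv (cheb (Suc r))) x"
    using le assms(1) by (intro mult_left_mono) auto
  finally have "poly (cheb (Suc r)) x \<le> x * poly (pderiv (cheb (Suc r))) x" .
  moreover have "poly (cheb (Suc r)) x > 0" using cheb_ge[OF assms(1), of "Suc r"] by auto
  ultimately show ?thesis using assms(1) r by (simp add: field_simps)
qed

section \<open>Positive functionals\<close>

locale positive_functional =
  fixes h :: "'a::star_calg \<Rightarrow> complex"
  assumes cfunctional: "cfunctional h" and nonneg: "0 \<le> h (star x * x)"
begin

lemma add: "h (x + y) = h x + h y" and scale: "h (c *\<^sub>C x) = c * h x"
  using cfunctional by (auto simp: cfunctional_iff)

lemma zero: "h 0 = 0"
  using scale[of 0 0] by simp

lemma diff: "h (x - y) = h x - h y"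
  using add[of "x - y" y] by simp

lemma sum: "h (sum f A) = (\<Sum>i\<in>A. h (f i))"
  by (induction A rule: infinite_finite_induct) (simp_all add: add zero)

text \<open>The values of \<open>h\<close> on elements \<open>star y * y\<close> are real. Taking
  \<open>y = 1 + c *\<^sub>C x\<close>, the choice \<open>c = 1\<close> settles the imaginary parts
  and \<open>c = \<i>\<close> the real parts.\<close>

lemma hermitian: "h (star x) = cnj (h x)"
proof -
  have eq: "h (star (1 + c *\<^sub>C x) * (1 + c *\<^sub>C x)) =
      h 1 + c * h x + cnj c * h (star x) + cnj c * c * h (star x * x)" for c
    by (simp add: star_add star_scaleC algebra_simps scaleC_mult_left scaleC_mult_right
        add scale)
  have im: "Im (h (star y * y)) = 0" for y
    using nonneg[of y] by (simp add: less_eq_complex_def)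
  have "Im (h 1) = 0" using im[of 1] by simp
  with eq[of 1] im[of "1 + 1 *\<^sub>C x"] im[of x] have "Im (h x) + Im (h (star x)) = 0" by simp
  moreover from eq[of \<i>] im[of "1 + \<i> *\<^sub>C x"] im[of x] \<open>Im (h 1) = 0\<close>
  have "Re (h x) = Re (h (star x))" by simp
  ultimately show ?thesis by (simp add: complex_eq_iff)
qed

lemma orthogonal_sym: "h (star y * x) = 0 \<Longrightarrow> h (star x * y) = 0"
  using hermitian[of "star y * x"] by (simp add: star_mult star_star)

text \<open>Polarization: the quadratic form of \<open>x - star x\<close> vanishes, and testing it
  on \<open>1 + c *\<^sub>C z\<close> with \<open>c = 1\<close> and \<open>c = \<i>\<close>
  separates the two mixed terms.\<close>

lemma star_eq_of_nonneg_form: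
  assumes "\<And>y. 0 \<le> h (star y * x * y)"
  shows "h (star x * z) = h (x * z)"
proof -
  define d where "d = x - star x"
  \<comment> \<open>Passing from \<open>x\<close> to \<open>star x\<close> conjugates the form, and
    its values are real by assumption.\<close>
  have *: "h (star y * d * y) = 0" for y
  proof -
    have "h (star y * star x * y) = cnj (h (star y * x * y))"
      using hermitian[of "star y * x * y"] by (simp add: star_mult star_star mult.assoc)
    moreover have "Im (h (star y * x * y)) = 0"
      using assms[of y] by (simp add: less_eq_complex_def)
    ultimately show ?thesis
      by (simp add: d_def algebra_simps diff complex_eq_iff)
  qed
  have "c * h (d * z) + cnj c * h (star z * d) = 0" for c
  proof -
    have "star (1 + c *\<^sub>C z) * d * (1 + c *\<^sub>C z) =
        d + c *\<^sub>C (d * z) + cnj c *\<^sub>C (star z * d) + (cnj c * c) *\<^sub>C (star z * d * z)"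
      by (simp add: star_add star_scaleC algebra_simps scaleC_mult_left scaleC_mult_right)
    from arg_cong[OF this, of h] show ?thesis
      using *[of "1 + c *\<^sub>C z"] *[of 1] *[of z] by (simp add: add scale)
  qed
  from this[of 1] this[of \<i>] have "h (d * z) = 0"
    by (simp add: complex_eq_iff)
  then show ?thesis by (simp add: d_def algebra_simps diff)
qed

end

text \<open>An operator that is its own absolute value is positive, and the left factor
  \<open>star y\<close> moves across the inner product to give its quadratic form at
  \<open>\<pi> y \<xi>\<close>.\<close>

lemma nonneg_form_if_positive_part:
  assumes "gns_representation h \<pi> \<xi>" and "x \<in> positive_part \<pi>"
  shows "0 \<le> h (star y * x * y)"
proof -
  have "h (star y * x * y) = cinner \<xi> (\<pi> (star y) (\<pi> x (\<pi> y \<xi>)))"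
    using assms(1) by (simp add: gns_representation_def)
  also have "\<dots> = cinner (\<pi> y \<xi>) (\<pi> x (\<pi> y \<xi>))"
    using assms(1) by (simp add: gns_representation_def adjoint_ops_def)
  finally show ?thesis
    using assms(2) by (simp add: positive_part_def is_abs_op_def positive_op_def)
qed

section \<open>Coefficient spaces\<close>

interpretation scalar_hom: semiring_hom "scalar :: complex \<Rightarrow> 'a::star_calg"
  by unfold_locales (simp_all add: scaleC_add_left scaleC_mult_left)

lemma entries_scalar_mult_left:
  assumes "cvec.subspace W" and "A \<in> carrier_mat n n" and "v \<in> carrier_mat n n"
    and "\<And>i j. i < n \<Longrightarrow> j < n \<Longrightarrow> v $$ (i, j) \<in> W" and "i < n" and "j < n"
  shows "(map_mat scalar A * v) $$ (i, j) \<in> W"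
proof -
  have "(map_mat scalar A * v) $$ (i, j) = (\<Sum>k<n. A $$ (i, k) *\<^sub>C v $$ (k, j))"
    using assms by (auto simp: scalar_prod_def scaleC_mult_left atLeast0LessThan)
  then show ?thesis
    using assms by (auto intro!: cvec.subspace_sum cvec.subspace_scale)
qed

lemma entries_scalar_mult_right:
  assumes "cvec.subspace W" and "A \<in> carrier_mat n n" and "v \<in> carrier_mat n n"
    and "\<And>i j. i < n \<Longrightarrow> j < n \<Longrightarrow> v $$ (i, j) \<in> W" and "i < n" and "j < n"
  shows "(v * map_mat scalar A) $$ (i, j) \<in> W"
proof -
  have "(v * map_mat scalar A) $$ (i, j) = (\<Sum>k<n. A $$ (k, j) *\<^sub>C v $$ (i, k))"
    using assms by (auto simp: scalar_prod_def scaleC_mult_right atLeast0LessThan)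
  then show ?thesis
    using assms by (auto intro!: cvec.subspace_sum cvec.subspace_scale)
qed

lemma coefficient_in:
  "i < dim_row v \<Longrightarrow> j < dim_col v \<Longrightarrow> v $$ (i, j) \<in> coefficient_space v"
  unfolding coefficient_space_def by (rule cvec.span_base) blast

lemma coefficient_space_subset:
  assumes "cvec.subspace W"
    and "\<And>i j. i < dim_row v \<Longrightarrow> j < dim_col v \<Longrightarrow> v $$ (i, j) \<in> W"
  shows "coefficient_space v \<subseteq> W"
  unfolding coefficient_space_def by (rule cvec.span_minimal) (use assms in auto)

lemma subspace_coefficient_space: "cvec.subspace (coefficient_space v)"
  unfolding coefficient_space_def by (rule cvec.subspace_span)

lemma coefficient_space_conjugate:
  assumes "v \<in> carrier_mat n n" and "A \<in> carrier_mat n n" and "B \<in> carrier_mat n n"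
  shows "coefficient_space (map_mat scalar A * v * map_mat scalar B) \<subseteq> coefficient_space v"
proof (rule coefficient_space_subset[OF subspace_coefficient_space])
  let ?P = "map_mat scalar A * v"
  have "?P \<in> carrier_mat n n" using assms by auto
  moreover have "?P $$ (i, j) \<in> coefficient_space v" if "i < n" "j < n" for i j
    using assms that
    by (intro entries_scalar_mult_left[OF subspace_coefficient_space]) (auto intro: coefficient_in)
  moreover fix i j assume "i < dim_row (?P * map_mat scalar B)" "j < dim_col (?P * map_mat scalar B)"
  ultimately show "(?P * map_mat scalar B) $$ (i, j) \<in> coefficient_space v"
    using assms by (intro entries_scalar_mult_right[OF subspace_coefficient_space]) auto
qed

text \<open>With \<open>S\<close> inverse to the intertwiner \<open>T\<close>, each of
  \<open>v\<close> and \<open>w\<close> is a conjugate of the other by scalar matrices, so its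
  entries are linear combinations of the other's entries.\<close>

lemma coefficient_space_equivalent:
  assumes "equivalent_corep v w" and "square_mat v" and "square_mat w"
  shows "coefficient_space v = coefficient_space w"
proof -
  obtain T :: "complex mat" where T: "invertible_mat T" "dim_row T = dim_row v"
      "dim_col T = dim_row w" "v * map_mat scalar T = map_mat scalar T * w"
    using assms(1) by (auto simp: equivalent_corep_def)
  define n where "n = dim_row v"
  from T(1) obtain S where "inverts_mat T S" "inverts_mat S T" "square_mat T"
    by (auto simp: invertible_mat_def)
  then have S: "T * S = 1\<^sub>m (dim_row T)" "S * T = 1\<^sub>m (dim_row S)"
    and "dim_col T = dim_row T"
    by (simp_all only: inverts_mat_def square_mat.simps)
  \<comment> \<open>Comparing column numbers in the two inverse identities fixes the shape of
    \<open>S\<close>.\<close>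
  moreover have "dim_col S = dim_row T" "dim_row S = dim_col T"
    using arg_cong[OF S(1), of dim_col] arg_cong[OF S(2), of dim_col] by simp_all
  moreover have "dim_col v = dim_row v" "dim_col w = dim_row w"
    using assms(2,3) by simp_all
  ultimately have car: "T \<in> carrier_mat n n" "S \<in> carrier_mat n n" "v \<in> carrier_mat n n"
      "w \<in> carrier_mat n n" and dims: "dim_row T = n" "dim_row S = n"
    using T(2,3) n_def by ((intro carrier_matI)?; linarith)+
  have inv: "T * S = 1\<^sub>m n" "S * T = 1\<^sub>m n" using S by (simp_all only: dims)
  let ?T = "map_mat scalar T" and ?S = "map_mat scalar S"
  have inv': "?T * ?S = (1\<^sub>m n :: 'a PolO mat)" "?S * ?T = (1\<^sub>m n :: 'a PolO mat)"
    using scalar_hom.mat_hom_mult[OF car(1,2), symmetric]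
      scalar_hom.mat_hom_mult[OF car(2,1), symmetric]
    by (simp_all only: inv scalar_hom.mat_hom_one)
  have car': "?T \<in> carrier_mat n n" "?S \<in> carrier_mat n n" using car by auto
  have "v = v * (?T * ?S)" unfolding inv' using car(3) by simp
  also have "\<dots> = v * ?T * ?S" by (rule assoc_mult_mat[symmetric, OF car(3) car'])
  finally have v: "v = ?T * w * ?S" unfolding T(4) .
  have "w = ?S * ?T * w" unfolding inv' using car(4) by simp
  also have "\<dots> = ?S * (v * ?T)" unfolding T(4) by (rule assoc_mult_mat[OF car'(2,1) car(4)])
  also have "\<dots> = ?S * v * ?T" by (rule assoc_mult_mat[symmetric, OF car'(2) car(3) car'(1)])
  finally have w: "w = ?S * v * ?T" .
  show ?thesis
    using coefficient_space_conjugate[OF car(4,1,2), folded v]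
      coefficient_space_conjugate[OF car(3,2,1), folded w] by (rule equalityI)
qed

lemma coefficient_space_direct_sum:
  assumes "square_mat v" and "square_mat w"
  shows "coefficient_space (direct_sum_corep v w) =
    cvec.span (coefficient_space v \<union> coefficient_space w)" (is "?L = ?R")
proof
  show "?L \<subseteq> ?R"
  proof (rule coefficient_space_subset[OF cvec.subspace_span])
    fix i j assume "i < dim_row (direct_sum_corep v w)" "j < dim_col (direct_sum_corep v w)"
    then show "direct_sum_corep v w $$ (i, j) \<in> ?R"
      using assms
      by (auto simp: direct_sum_corep_def square_mat.simps cvec.span_zero
          intro!: cvec.span_base coefficient_in)
  qed
  have "v $$ (i, j) \<in> ?L" if "i < dim_row v" "j < dim_col v" for i j
    using that coefficient_in[of i "direct_sum_corep v w" j]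
    by (simp add: direct_sum_corep_def)
  moreover have "w $$ (i, j) \<in> ?L" if "i < dim_row w" "j < dim_col w" for i j
    using that coefficient_in[of "dim_row v + i" "direct_sum_corep v w" "dim_col v + j"]
    by (simp add: direct_sum_corep_def)
  ultimately show "?R \<subseteq> ?L"
    by (intro cvec.span_minimal Un_least coefficient_space_subset subspace_coefficient_space)
qed

text \<open>Undoes the \<open>div\<close>/\<open>mod\<close> encoding of index pairs, so that every
  product of an entry of \<open>v\<close> and an entry of \<open>w\<close> is seen to occur.\<close>

lemma tensor_corep_index:
  assumes "i < dim_row v" "k < dim_row w" "j < dim_col v" "l < dim_col w"
  shows "i * dim_row w + k < dim_row v * dim_row w"
    and "j * dim_col w + l < dim_col v * dim_col w"
    and "tensor_corep v w $$ (i * dim_row w + k, j * dim_col w + l) = v $$ (i, j) * w $$ (k, l)"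
proof -
  have bound: "a * n + b < m * n" if "a < m" "b < n" for a b m n :: nat
  proof -
    have "a * n + b < Suc a * n" using that by simp
    also have "\<dots> \<le> m * n" using that by (intro mult_right_mono) auto
    finally show ?thesis .
  qed
  show "i * dim_row w + k < dim_row v * dim_row w" "j * dim_col w + l < dim_col v * dim_col w"
    using assms by (auto intro: bound)
  then show "tensor_corep v w $$ (i * dim_row w + k, j * dim_col w + l) = v $$ (i, j) * w $$ (k, l)"
    using assms by (simp add: tensor_corep_def)
qed

lemma subspace_vimage_mult: "cvec.subspace W \<Longrightarrow> cvec.subspace {x. a * x \<in> W}"
  for a :: "'a::star_calg"
  by (rule cvec.subspaceI)
    (auto simp: distrib_left scaleC_mult_right cvec.subspace_def)

text \<open>For the inclusion of the right side, products of entries are extended linearly in the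
  second factor with an entry of \<open>v\<close> fixed, and then in the first factor.\<close>

lemma coefficient_space_tensor:
  "coefficient_space (tensor_corep v w) =
    cvec.span {a * b | a b. a \<in> coefficient_space v \<and> b \<in> coefficient_space w}" (is "?L = ?R")
proof
  show "?L \<subseteq> ?R"
  proof (rule coefficient_space_subset[OF cvec.subspace_span])
    fix i j assume ij: "i < dim_row (tensor_corep v w)" "j < dim_col (tensor_corep v w)"
    then have "v $$ (i div dim_row w, j div dim_col w) \<in> coefficient_space v"
      by (intro coefficient_in) (auto simp: tensor_corep_def less_mult_imp_div_less)
    moreover have "w $$ (i mod dim_row w, j mod dim_col w) \<in> coefficient_space w"
      using ij by (intro coefficient_in) (auto simp: tensor_corep_def intro!: mod_less_divisor gr0I)
    ultimately show "tensor_corep v w $$ (i, j) \<in> ?R"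
      using ij by (auto simp: tensor_corep_def intro!: cvec.span_base)
  qed
  have entries: "v $$ (i, j) * w $$ (k, l) \<in> ?L"
    if "i < dim_row v" "j < dim_col v" "k < dim_row w" "l < dim_col w" for i j k l
    using tensor_corep_index[of i v k w j l] that
      coefficient_in[of "i * dim_row w + k" "tensor_corep v w" "j * dim_col w + l"]
    by (simp add: tensor_corep_def)
  have right: "coefficient_space w \<subseteq> {b. v $$ (i, j) * b \<in> ?L}"
    if "i < dim_row v" "j < dim_col v" for i j
    using entries that
    by (intro coefficient_space_subset subspace_vimage_mult subspace_coefficient_space) auto
  have "coefficient_space v \<subseteq> {a. a * b \<in> ?L}" if "b \<in> coefficient_space w" for b
  proof (rule coefficient_space_subset)
    show "cvec.subspace {a. a * b \<in> ?L}"
      using subspace_coefficient_space[of "tensor_corep v w"]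
      by (intro cvec.subspaceI) (auto simp: distrib_right scaleC_mult_left cvec.subspace_def)
  qed (use right that in auto)
  then show "?R \<subseteq> ?L"
    by (intro cvec.span_minimal subspace_coefficient_space) auto
qed

section \<open>The Haar state on coefficients\<close>

lemma slice_sum:
  assumes "cfunctional f"
  shows "slice_right f (sum g A) = (\<Sum>k\<in>A. slice_right f (g k))"
proof -
  have "slice_right f 0 = 0" using slice_add(2)[OF assms, of 0 0] by simp
  then show ?thesis
    by (induction A rule: infinite_finite_induct) (simp_all add: slice_add(2)[OF assms])
qed

text \<open>By invariance, the columns of the matrix of values of \<open>h\<close> are fixed vectors of \<open>v\<close>,
  so they span invariant subspaces of dimension at most one.\<close>

lemma haar_state_irreducible:
  assumes "haar_state h" and v: "irreducible_corep v" and "dim_row v \<ge> 2"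
    and "i < dim_row v" and "j < dim_col v"
  shows "h (v $$ (i, j)) = 0"
proof -
  define d where "d = dim_row v"
  have h: "cfunctional h" "\<And>x. slice_right h (\<Delta> x) = scalar (h x)"
    using assms(1) by (auto simp: haar_state_def)
  have dc: "dim_col v = d"
    using v by (simp add: irreducible_corep_def corepresentation_def invertible_mat_def
        square_mat.simps d_def)
  define w where "w = vec d (\<lambda>k. h (v $$ (k, j)))"
  have w: "w \<in> carrier_vec d" by (simp add: w_def)
  \<comment> \<open>Applying \<open>slice_right h\<close> to the comultiplication of column
    \<open>j\<close> turns invariance of \<open>h\<close> into this fixed-vector equation.\<close>
  have fixed: "(\<Sum>k<d. (w $ k) *\<^sub>C v $$ (a, k)) = scalar (w $ a)" if "a < d" for a
  proof -
    have "\<Delta> (v $$ (a, j)) = (\<Sum>k<d. v $$ (a, k) \<otimes>\<^sub>A v $$ (k, j))"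
      using v that assms(5) dc by (simp add: irreducible_corep_def corepresentation_def d_def)
    then show ?thesis
      using h(2)[of "v $$ (a, j)"] that by (simp add: slice_sum[OF h(1)] slice_tens[OF h(1)] w_def)
  qed
  define W where "W = {c \<cdot>\<^sub>v w | c. True}"
  have sub: "vec_subspace d W"
    unfolding vec_subspace_def
  proof (intro conjI ballI allI)
    show "W \<subseteq> carrier_vec d" using w by (auto simp: W_def)
    have "0\<^sub>v d = 0 \<cdot>\<^sub>v w" using w by auto
    then show "0\<^sub>v d \<in> W" unfolding W_def by blast
    show "x + y \<in> W" if "x \<in> W" "y \<in> W" for x y
      using that by (auto simp: W_def simp flip: add_smult_distrib_vec)
    show "c \<cdot>\<^sub>v x \<in> W" if "x \<in> W" for x c
      using that by (auto simp: W_def smult_smult_assoc)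
  qed
  have "invariant_subspace v W"
    unfolding invariant_subspace_def d_def[symmetric]
  proof (intro conjI ballI sub)
    fix x assume x: "x \<in> W"
    then obtain c where c: "x = c \<cdot>\<^sub>v w" by (auto simp: W_def)
    \<comment> \<open>A fixed vector \<open>x\<close> goes to its tensor product with 1, written as
      a sum of one term to match \<open>vec_subspace_ext\<close>.\<close>
    have "v *\<^sub>v map_vec scalar x = vec d (\<lambda>a. \<Sum>k<(1::nat). (x $ a) *\<^sub>C 1)"
    proof (rule eq_vecI)
      fix a assume "a < dim_vec (vec d (\<lambda>a. \<Sum>k<(1::nat). (x $ a) *\<^sub>C (1 :: 'a PolO)))"
      then have a: "a < d" by simp
      have "(v *\<^sub>v map_vec scalar x) $ a = (\<Sum>k<d. (c * w $ k) *\<^sub>C v $$ (a, k))"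
        using a w by (simp add: scalar_prod_def c scaleC_mult_right atLeast0LessThan d_def dc[unfolded d_def])
      also have "\<dots> = c *\<^sub>C (\<Sum>k<d. (w $ k) *\<^sub>C v $$ (a, k))"
        by (simp add: cvec.scale_sum_right)
      finally show "(v *\<^sub>v map_vec scalar x) $ a = vec d (\<lambda>a. \<Sum>k<(1::nat). (x $ a) *\<^sub>C 1) $ a"
        using a w fixed[OF a] by (simp add: c)
    qed (simp add: d_def)
    with x show "v *\<^sub>v map_vec scalar x \<in> vec_subspace_ext d W"
      unfolding vec_subspace_ext_def
      by (intro CollectI exI[of _ "1::nat"] exI[of _ "\<lambda>_. x"] exI[of _ "\<lambda>_. 1"]) auto
  qed
  then have "W = {0\<^sub>v d} \<or> W = carrier_vec d"
    using v by (simp add: irreducible_corep_def d_def)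
  moreover have "W \<noteq> carrier_vec d"
  proof
    assume "W = carrier_vec d"
    \<comment> \<open>Since \<open>d \<ge> 2\<close> there are two different unit vectors, and they
      cannot both be multiples of \<open>w\<close>.\<close>
    then have "unit_vec d 0 \<in> W" "unit_vec d 1 \<in> W" by auto
    then obtain b c where bc: "unit_vec d 0 = b \<cdot>\<^sub>v w" "unit_vec d 1 = c \<cdot>\<^sub>v w"
      by (auto simp: W_def)
    have "d \<ge> 2" using assms(3) by (simp add: d_def)
    then have "b * w $ 0 = 1" "b * w $ 1 = 0" "c * w $ 1 = 1"
      using arg_cong[OF bc(1), of "\<lambda>u. u $ 0"] arg_cong[OF bc(1), of "\<lambda>u. u $ 1"]
        arg_cong[OF bc(2), of "\<lambda>u. u $ 1"] w by auto
    then show False by auto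
  qed
  moreover have "w \<in> W" unfolding W_def using one_smult_vec[of w] by force
  ultimately have "w = 0\<^sub>v d" by auto
  then have "w $ i = 0" using assms(4) by (simp add: d_def)
  then show ?thesis using assms(4) by (simp add: w_def d_def)
qed

section \<open>The spaces \<open>V s\<close> and multiplication by generators\<close>

locale free_orthogonal =
  fixes h :: "'n::finite PolO \<Rightarrow> complex" and U :: "nat \<Rightarrow> 'n PolO mat"
  assumes card: "CARD('n) \<ge> 2" and haar: "haar_state h" and irr: "irreducibles_O U"
begin

sublocale positive_functional h
  using haar by (intro positive_functional.intro) (auto simp: haar_state_def)

abbreviation V :: "nat \<Rightarrow> 'n PolO set" where
  "V s \<equiv> coefficient_space (U s)"

lemma square: "square_mat (U s)"
  using irr
  by (auto simp: irreducibles_O_def irreducible_corep_def corepresentation_def invertible_mat_def)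

lemma V_0: "x \<in> V 0 \<longleftrightarrow> (\<exists>c. x = scalar c)"
proof
  have U0: "U 0 = 1\<^sub>m 1" using irr by (simp add: irreducibles_O_def)
  have "cvec.subspace (range scalar :: 'n PolO set)"
    by (rule cvec.subspaceI) (auto simp flip: scaleC_add_left intro: range_eqI[of _ _ 0])
  then have "V 0 \<subseteq> range scalar"
    by (rule coefficient_space_subset) (auto simp: U0 intro: range_eqI[of _ _ 1])
  then show "x \<in> V 0 \<Longrightarrow> \<exists>c. x = scalar c" by auto
  have "1 \<in> V 0" using coefficient_in[of 0 "U 0" 0] by (simp add: U0)
  then show "\<exists>c. x = scalar c \<Longrightarrow> x \<in> V 0"
    using subspace_coefficient_space[of "U 0"] by (auto simp: cvec.subspace_def)
qed

lemma V_1: "V 1 = cvec.span {ugen i j | i j. True}"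
proof -
  obtain e where e: "bij_betw e {..<CARD('n)} (UNIV :: 'n set)"
    and U1: "U 1 = mat CARD('n) CARD('n) (\<lambda>(i, j). ugen (e i) (e j))"
    using irr by (auto simp: irreducibles_O_def)
  have entry: "U 1 $$ (i, j) = ugen (e i) (e j)" if "i < CARD('n)" "j < CARD('n)" for i j
    using that by (simp only: U1 index_mat) simp
  have "\<exists>a<CARD('n). i = e a" for i
    using bij_betw_imp_surj_on[OF e] by blast
  then obtain a where a: "\<And>i. a i < CARD('n)" "\<And>i. i = e (a i)" by metis
  have "{U 1 $$ (i, j) | i j. i < CARD('n) \<and> j < CARD('n)} = {ugen i j | i j. True}"
  proof (intro subset_antisym subsetI)
    fix x :: "'n PolO" assume "x \<in> {ugen i j | i j. True}"
    then obtain i j where "x = ugen i j" by blast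
    then have "x = U 1 $$ (a i, a j)" using entry a by metis
    then show "x \<in> {U 1 $$ (i, j) | i j. i < CARD('n) \<and> j < CARD('n)}" using a(1) by blast
  qed (use entry in blast)
  moreover have "dim_row (U 1) = CARD('n)" "dim_col (U 1) = CARD('n)"
    by (simp_all only: U1 dim_row_mat dim_col_mat)
  ultimately show ?thesis by (simp only: coefficient_space_def)
qed

text \<open>The fusion rule read on coefficients: equivalence preserves the coefficient space,
  tensor products yield products, direct sums yield sums of spaces.\<close>

lemma span_V1_mult:
  assumes "s \<ge> 1"
  shows "cvec.span {a * b | a b. a \<in> V 1 \<and> b \<in> V s} = cvec.span (V (s + 1) \<union> V (s - 1))"
proof -
  have "equivalent_corep (tensor_corep (U 1) (U s)) (direct_sum_corep (U (s + 1)) (U (s - 1)))"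
    using irr assms by (simp add: irreducibles_O_def)
  moreover have "square_mat (tensor_corep (U 1) (U s))"
    using square[of 1] square[of s] by (simp add: tensor_corep_def square_mat.simps)
  moreover have "square_mat (direct_sum_corep (U (s + 1)) (U (s - 1)))"
    using square[of "s + 1"] square[of "s - 1"] by (simp add: direct_sum_corep_def square_mat.simps)
  ultimately have "coefficient_space (tensor_corep (U 1) (U s)) =
      coefficient_space (direct_sum_corep (U (s + 1)) (U (s - 1)))"
    by (rule coefficient_space_equivalent)
  then show ?thesis
    unfolding coefficient_space_tensor coefficient_space_direct_sum[OF square square] .
qed

text \<open>The neighbours of \<open>s\<close> are described by \<open>Suc t = s\<close> instead of
  \<open>s - 1\<close>, so that only 1 remains for \<open>s = 0\<close>; that case rests on
  \<open>V_0\<close>, the others on the fusion rule.\<close>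

lemma ugen_mult_V:
  assumes "x \<in> V s"
  shows "ugen i j * x \<in> cvec.span (\<Union>t\<in>{t. t = Suc s \<or> Suc t = s}. V t)"
proof (cases s)
  case 0
  then obtain c where "x = scalar c" using assms by (auto simp: V_0)
  moreover have "ugen i j \<in> V 1" unfolding V_1 by (rule cvec.span_base) blast
  ultimately have "ugen i j * x \<in> V (Suc s)"
    using 0 cvec.subspace_scale[OF subspace_coefficient_space] by (simp add: scaleC_mult_right)
  then show ?thesis by (intro cvec.span_base) blast
next
  case (Suc r)
  have "ugen i j \<in> V 1" unfolding V_1 by (rule cvec.span_base) blast
  then have "ugen i j * x \<in> cvec.span (V (s + 1) \<union> V (s - 1))"
    using assms span_V1_mult[of s] Suc cvec.span_base[of "ugen i j * x" "{a * b | a b. a \<in> V 1 \<and> b \<in> V s}"]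
    by auto
  then show ?thesis
    by (rule rev_subsetD) (intro cvec.span_mono, use Suc in auto)
qed

text \<open>Lets inductions on the index peel one generator off on the left. For
  \<open>s \<ge> 1\<close> the fusion rule places \<open>V (Suc s)\<close> in the span of
  \<open>V 1\<close> times \<open>V s\<close>, and \<open>V 1\<close> is spanned by
  generators.\<close>

lemma V_Suc: "V (Suc s) \<subseteq> cvec.span {ugen i j * x | i j x. x \<in> V s}" (is "_ \<subseteq> ?R")
proof (cases s)
  case 0
  have "{ugen i j | i j. True} \<subseteq> {ugen i j * x | i j x. x \<in> V 0}"
    using V_0[of 1] by (force intro: exI[of _ 1])
  then show ?thesis using 0 V_1 cvec.span_mono[of "{ugen i j | i j. True}"] by simp
next
  case (Suc r)
  have "V 1 \<subseteq> {a. a * b \<in> ?R}" if "b \<in> V s" for b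
    unfolding V_1
  proof (rule cvec.span_minimal)
    show "cvec.subspace {a. a * b \<in> ?R}"
      by (intro cvec.subspaceI)
        (auto simp: distrib_right scaleC_mult_left intro: cvec.span_zero cvec.span_add cvec.span_scale)
  qed (use that in \<open>auto intro!: cvec.span_base\<close>)
  then have "cvec.span {a * b | a b. a \<in> V 1 \<and> b \<in> V s} \<subseteq> ?R"
    by (intro cvec.span_minimal cvec.subspace_span) auto
  then show ?thesis
    using span_V1_mult[of s] Suc cvec.span_superset[of "V (s + 1) \<union> V (s - 1)"] by auto
qed

section \<open>Orthogonality of the spaces \<open>V s\<close>\<close>

lemma h_V:
  assumes "s \<ge> 1" and "x \<in> V s"
  shows "h x = 0"
proof -
  have "real (dim_row (U s)) = poly (cheb s) (real CARD('n))"
    and irr': "irreducible_corep (U s)"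
    using irr by (auto simp: irreducibles_O_def)
  moreover obtain r where "s = Suc r" using assms(1) by (cases s) auto
  \<comment> \<open>The dimension is at least \<open>poly (cheb r) N + 1\<close>, where the first
    summand is at least 1.\<close>
  ultimately have "dim_row (U s) \<ge> 2"
    using cheb_ge[of "real CARD('n)" r] card by simp
  then have "V s \<subseteq> {x. h x = 0}"
    using haar_state_irreducible[OF haar irr']
    by (intro coefficient_space_subset cvec.subspaceI) (auto simp: add scale zero)
  then show ?thesis using assms by auto
qed

text \<open>Moving the generators from \<open>V r\<close> over to \<open>V s\<close> lowers \<open>s\<close> by at most one each time, so
  the trivial component \<open>V 0\<close> is not reached.\<close>

lemma orthogonal_less:
  assumes "r < s" and "y \<in> V r" and "x \<in> V s"
  shows "h (star y * x) = 0"
  using assms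
proof (induction r arbitrary: s x y)
  case 0
  then obtain c where "y = scalar c" by (auto simp: V_0)
  then show ?case using h_V[of s x] 0 by (simp add: star_scaleC scaleC_mult_left scale)
next
  case (Suc r)
  let ?K = "{y. h (star y * x) = 0}"
  \<comment> \<open>Generators are self-adjoint, so
    \<open>star (ugen i j * b) * x = star b * (ugen i j * x)\<close>.\<close>
  have "ugen i j * b \<in> ?K" if b: "b \<in> V r" for i j b
  proof -
    have "cvec.span (\<Union>t\<in>{t. t = Suc s \<or> Suc t = s}. V t) \<subseteq> {z. h (star b * z) = 0}"
    proof (rule cvec.span_minimal)
      show "cvec.subspace {z. h (star b * z) = 0}"
        by (rule cvec.subspaceI) (auto simp: distrib_left scaleC_mult_right add scale zero)
      show "(\<Union>t\<in>{t. t = Suc s \<or> Suc t = s}. V t) \<subseteq> {z. h (star b * z) = 0}"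
      proof clarify
        fix t z assume "t = Suc s \<or> Suc t = s" "z \<in> V t"
        \<comment> \<open>From \<open>Suc r < s\<close> and \<open>s \<le> Suc t\<close>: both
          indices have dropped by at most one, so the strict inequality survives.\<close>
        moreover from this have "r < t" using Suc.prems(1) by auto
        ultimately show "h (star b * z) = 0" using Suc.IH[OF _ b] by blast
      qed
    qed
    then show ?thesis
      using ugen_mult_V[OF Suc.prems(3), of i j] by (auto simp: star_mult star_u mult.assoc)
  qed
  moreover have "cvec.subspace ?K"
    by (rule cvec.subspaceI)
      (auto simp: star_add star_scaleC distrib_right scaleC_mult_left add scale zero)
  ultimately have "cvec.span {ugen i j * b | i j b. b \<in> V r} \<subseteq> ?K"
    by (intro cvec.span_minimal) auto
  then show ?case using V_Suc[of r] Suc.prems(2) by auto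
qed

lemma orthogonal: "r \<noteq> s \<Longrightarrow> y \<in> V r \<Longrightarrow> x \<in> V s \<Longrightarrow> h (star y * x) = 0"
  using orthogonal_less orthogonal_sym by (metis linorder_neqE_nat)

section \<open>Decomposition into components and the Parseval identity\<close>

lemma span_V: "x \<in> cvec.span (\<Union>s. V s)" (is "_ \<in> ?W")
proof -
  have gen: "?W \<subseteq> {w. ugen i j * w \<in> ?W}" for i j
  proof (rule cvec.span_minimal)
    show "(\<Union>s. V s) \<subseteq> {w. ugen i j * w \<in> ?W}"
    proof safe
      fix w s assume "w \<in> V s"
      then have "ugen i j * w \<in> cvec.span (\<Union>t\<in>{t. t = Suc s \<or> Suc t = s}. V t)"
        by (rule ugen_mult_V)
      also have "\<dots> \<subseteq> ?W" by (rule cvec.span_mono) auto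
      finally show "ugen i j * w \<in> ?W" .
    qed
  qed (intro subspace_vimage_mult cvec.subspace_span)
  \<comment> \<open>An expression and its star are treated together because \<open>OStar\<close>
    exchanges them. Applied to \<open>w = 1\<close>, this shows that the span is everything.\<close>
  have "\<forall>w\<in>?W. abs_PolO e * w \<in> ?W \<and> star (abs_PolO e) * w \<in> ?W" for e
  proof (induction e)
    case (OGen i j)
    then show ?case using gen by (auto simp: star_u simp flip: ugen.abs_eq)
  next
    case (OConst c)
    then show ?case
      by (auto simp: star_scaleC scaleC_mult_left cvec.span_scale simp flip: scalar_PolO)
  next
    case (OAdd a b)
    then show ?case
      by (auto simp: star_add distrib_right cvec.span_add simp flip: plus_PolO.abs_eq)
  next
    case (OMul a b)
    then show ?case by (auto simp: star_mult mult.assoc simp flip: times_PolO.abs_eq)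
  next
    case (OStar a)
    then show ?case by (auto simp: star_star simp flip: star_PolO.abs_eq)
  qed
  moreover have "1 \<in> ?W" using V_0[of 1] by (intro cvec.span_base UN_I[of 0]) (auto intro: exI[of _ 1])
  moreover have "\<exists>e. x = abs_PolO e" by (induct x rule: PolO.abs_induct) auto
  ultimately show ?thesis by force
qed

lemma decomposition:
  obtains A f where "finite A" "\<And>s. f s \<in> V s" "x = (\<Sum>s\<in>A. f s)"
proof -
  have zero: "0 \<in> V s" and add: "a \<in> V s \<Longrightarrow> b \<in> V s \<Longrightarrow> a + b \<in> V s"
    and scale: "a \<in> V s \<Longrightarrow> c *\<^sub>C a \<in> V s" for s a b c
    using subspace_coefficient_space[of "U s"] by (auto simp: cvec.subspace_def)
  \<comment> \<open>Vanishing of \<open>f\<close> outside \<open>A\<close> allows a new index to be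
    inserted into \<open>A\<close> without changing the sum.\<close>
  have "\<exists>A f. finite A \<and> (\<forall>s. f s \<in> V s) \<and> (\<forall>s. s \<notin> A \<longrightarrow> f s = 0) \<and> x = (\<Sum>s\<in>A. f s)"
    using span_V[of x]
  proof (induction rule: cvec.span_induct_alt)
    case base
    show ?case by (rule exI[of _ "{}"], rule exI[of _ "\<lambda>_. 0"]) (simp add: zero)
  next
    case (step c x y)
    then obtain A f s where *: "finite A" "\<forall>s. f s \<in> V s" "\<forall>s. s \<notin> A \<longrightarrow> f s = 0"
      "y = (\<Sum>s\<in>A. f s)" "x \<in> V s" by auto
    have "(\<Sum>t\<in>insert s A. f t) = y"
      using * by (cases "s \<in> A") (auto simp: insert_absorb)
    then have "c *\<^sub>C x + y = (\<Sum>t\<in>insert s A. f t + (if t = s then c *\<^sub>C x else 0))"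
      using * by (simp add: sum.distrib add.commute)
    then show ?case using *
      by (intro exI[of _ "insert s A"] exI[of _ "\<lambda>t. f t + (if t = s then c *\<^sub>C x else 0)"])
        (auto intro!: add scale)
  qed
  then show ?thesis using that by blast
qed

text \<open>The weights serve both sides of the inequality: \<open>c s = 1\<close> gives the squared
  norm, and the eigenvalues of the generator give the energy.\<close>

lemma parseval:
  assumes "finite A" and "\<And>s. f s \<in> V s"
  shows "h (star (\<Sum>s\<in>A. f s) * (\<Sum>s\<in>A. c s *\<^sub>C f s)) = (\<Sum>s\<in>A. c s * h (star (f s) * f s))"
proof -
  have "h (star (\<Sum>s\<in>A. f s) * (\<Sum>s\<in>A. c s *\<^sub>C f s)) =
      (\<Sum>r\<in>A. \<Sum>s\<in>A. c s * h (star (f r) * f s))"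
    by (simp add: star_sum sum_product sum scaleC_mult_right scale)
  also have "\<dots> = (\<Sum>r\<in>A. \<Sum>s\<in>A. if s = r then c s * h (star (f s) * f s) else 0)"
    using orthogonal[OF _ assms(2) assms(2)] by (intro sum.cong refl) auto
  finally show ?thesis using assms(1) by simp
qed

text \<open>Subtracting the mean deletes exactly the component in \<open>V 0\<close>:
  \<open>h\<close> reproduces the scalar \<open>f 0\<close> and vanishes on the other
  components.\<close>

lemma subtract_haar:
  assumes "finite A" and "\<And>s. f s \<in> V s"
  shows "(\<Sum>s\<in>A. f s) - scalar (h (\<Sum>s\<in>A. f s)) = (\<Sum>s\<in>A - {0}. f s)"
proof -
  obtain c where c: "f 0 = scalar c" using assms(2)[of 0] by (auto simp: V_0)
  have "h 1 = 1" using haar by (simp add: haar_state_def)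
  then have h0: "scalar (h (f 0)) = f 0" by (simp add: c scale)
  have "(\<Sum>s\<in>A - {0}. h (f s)) = 0" using h_V[OF _ assms(2)] by (intro sum.neutral) auto
  then have rest: "h (\<Sum>s\<in>A - {0}. f s) = 0" by (simp only: sum)
  show ?thesis
  proof (cases "0 \<in> A")
    case True
    have "(\<Sum>s\<in>A. f s) = f 0 + (\<Sum>s\<in>A - {0}. f s)"
      using assms(1) True by (rule sum.remove)
    then show ?thesis by (simp only: add rest h0 add_0_right add_diff_cancel_left')
  next
    case False
    then show ?thesis using rest by simp
  qed
qed

end

section \<open>Termwise comparison of variance and energy\<close>

theorem proposition3p2:
  fixes h :: "'n::finite PolO \<Rightarrow> complex"
    and \<pi> :: "'n PolO \<Rightarrow> 'k::chilbert \<Rightarrow> 'k" and \<xi> :: 'k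
    and U :: "nat \<Rightarrow> 'n PolO mat"
    and T\<^sub>L :: "'n PolO \<Rightarrow> 'n PolO"
    and T :: "real \<Rightarrow> 'n PolO \<Rightarrow> 'n PolO"
  assumes "CARD('n) \<ge> 2"
    and "haar_state h"
    and "gns_representation h \<pi> \<xi>"
    and "irreducibles_O U"
    and "heat_generator U T\<^sub>L"
    and "exp_semigroup T\<^sub>L T"
  shows "\<forall>x\<in>positive_part \<pi>.
    complex_of_real (1 / real CARD('n) * (norm2 h (x - scalar (h x)))\<^sup>2) \<le> - h (x * T\<^sub>L x)"
proof
  interpret free_orthogonal h U using assms by unfold_locales
  fix x assume x: "x \<in> positive_part \<pi>"
  obtain A f where A: "finite A" and f: "\<And>s. f s \<in> V s" and xf: "x = (\<Sum>s\<in>A. f s)"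
    using decomposition by metis
  let ?N = "real CARD('n)"
  define l where "l s = poly (pderiv (cheb s)) ?N / poly (cheb s) ?N" for s
  define q where "q s = Re (h (star (f s) * f s))" for s
  have q: "h (star (f s) * f s) = complex_of_real (q s)" "q s \<ge> 0" for s
    using nonneg[of "f s"] by (auto simp: q_def less_eq_complex_def complex_eq_iff)
  \<comment> \<open>The factors 1 bring the second sum into the form required by
    \<open>parseval\<close>.\<close>
  have "norm2 h (x - scalar (h x))^2 = Re (h (star (\<Sum>s\<in>A - {0}. f s) * (\<Sum>s\<in>A - {0}. 1 *\<^sub>C f s)))"
    using nonneg[of "\<Sum>s\<in>A - {0}. f s"]
    by (simp add: norm2_def xf subtract_haar[OF A f] less_eq_complex_def)
  also have "\<dots> = (\<Sum>s\<in>A - {0}. q s)"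
    using A by (subst parseval[OF _ f]) (auto simp: q)
  finally have norm: "(norm2 h (x - scalar (h x)))\<^sup>2 = (\<Sum>s\<in>A - {0}. q s)" .
  have L: "Vector_Spaces.linear scaleC scaleC T\<^sub>L" "\<And>s x. x \<in> V s \<Longrightarrow> T\<^sub>L x = complex_of_real (- l s) *\<^sub>C x"
    using assms(5) by (auto simp: heat_generator_def l_def)
  have "T\<^sub>L x = (\<Sum>s\<in>A. complex_of_real (- l s) *\<^sub>C f s)"
    unfolding xf module_hom.sum[OF L(1)[THEN Vector_Spaces.linear.axioms(3)]]
    using L(2)[OF f] by simp
  moreover have "h (x * T\<^sub>L x) = h (star x * T\<^sub>L x)"
    using star_eq_of_nonneg_form[of x] nonneg_form_if_positive_part[OF assms(3) x] by simp
  \<comment> \<open>In particular the energy is real, so the complex order reduces to a comparison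
    of real sums.\<close>
  ultimately have "- h (x * T\<^sub>L x) = complex_of_real (\<Sum>s\<in>A. l s * q s)"
    using parseval[OF A f, of "\<lambda>s. complex_of_real (- l s)"]
    by (simp add: xf q sum_negf)
  moreover have "1 / ?N * (\<Sum>s\<in>A - {0}. q s) \<le> (\<Sum>s\<in>A. l s * q s)"
  proof -
    have "1 / ?N * (\<Sum>s\<in>A - {0}. q s) = (\<Sum>s\<in>A - {0}. 1 / ?N * q s)"
      by (simp add: sum_distrib_left)
    also have "\<dots> \<le> (\<Sum>s\<in>A - {0}. l s * q s)"
      using cheb_log_derivative_ge[of ?N] assms(1) q(2)
      by (intro sum_mono mult_right_mono) (auto simp: l_def)
    \<comment> \<open>The index 0 may be restored because \<open>cheb 0\<close> is constant, hence
      \<open>l 0 = 0\<close>.\<close>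
    also have "\<dots> = (\<Sum>s\<in>A. l s * q s)"
      using A by (intro sum.mono_neutral_left) (auto simp: l_def cheb_0)
    finally show ?thesis .
  qed
  ultimately show "complex_of_real (1 / ?N * (norm2 h (x - scalar (h x)))\<^sup>2) \<le> - h (x * T\<^sub>L x)"
    unfolding norm by (simp add: less_eq_complex_def)
qed

end
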